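(* Let $M = M^0(S; F(I), G(\Lambda); P)$ be a Rees matrix semigroup with zero over a semigroupoid $S$. Suppose $M$ is automatic, and the set of non-identity elements of $S$ is weakly right-ideal-generated by a row cross-section of $P$. Then $S$ is automatic.
   Context: Semigroupoids. A (directed) graph $X$ has a set $X^0$ of vertices, a set $X^1$ of edges, and source and target maps $\alpha,\omega: X^1\to X^0$. A semigroupoid $S$ is a small graph (vertices are called objects, edges are called arrows) with a partial multiplication on arrows such that $ef$ is defined if and only if $\omega(e)=\alpha(f)$, in which case $\alpha(ef)=\alpha(e)$ and $\omega(ef)=\omega(f)$, and $e(fg)=(ef)g$ whenever $ef$ and $fg$ are defined. (Thus a semigroupoid is a small category without the requirement of identities.) We write $s\in S$ for $s\in S^1$. $S$ is isolation-free if every object is the source or target of some arrow. A semigroup is regarded as a semigroupoid with one object. An identity element of $S$ is an arrow $e$ with $\alpha(e)=\omega(e)$ such that $es=s$ and $te=t$ whenever these products are defined. Paths and regularity. For a graph $X$, $X^+$ is the free semigroupoid on $X$: its objects are $X^0$, its arrows are the non-empty paths $e_1\cdots e_n$ with $\omega(e_i)=\alpha(e_{i+1})$. All graphs over which regularity is considered are finite. A language $L\subseteq X^+$ is regular if it is regular in the usual sense as a set of words over the alphabet $X^1$ (equivalently, it is accepted by a finite automaton labelled by the graph $X$). Let $X^{\$}$ be $X$ with one extra loop $\$_s$ at each vertex $s$. For $(a,b)\in X^+\times X^+$, let $\delta_X(a,b)\in (X^{\$}\times X^{\$})^+$ be the path obtained by padding the shorter of $a,b$ on the right with copies of $\$_t$,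 where $t$ is the target of that shorter path, to the length of the longer one, and reading the two paths as a single path of pairs of edges. A relation $R\subseteq X^+\times X^+$ is synchronously regular if $\delta_X(R)$ is a regular language (over the edges of $X^{\$}\times X^{\$}$). Automaticity. A choice of representatives for a semigroupoid $S$ is a triple $(X,K,\rho)$ where $X$ is a graph with $X^0=S^0$, $\rho:X^+\to S$ is a surjective semigroupoid morphism that is the identity on objects, and $K\subseteq X^+$ satisfies $\rho(K)=S^1$. It is finitely generated if $X$ has finitely many edges. An automatic structure for $S$ is a finitely generated choice of representatives $(X,K,\rho)$ such that the relation $K_a=\{(u,v)\in K\times K : \omega(u)=\alpha(a),\ \rho(ua)=\rho(v)\}$ is synchronously regular for each edge $a\in X^1$, and the relation $K_a=\{(u,v)\in K\times K: \omega(u)=a,\ \rho(u)=\rho(v)\}$ is synchronously regular for each vertex $a\in X^0$ (regarded as an empty path). $S$ is automatic if it admits an automatic structure. Rees matrix semigroups. Let $S$ be a non-empty isolation-free semigroupoid, $I,\Lambda$ index sets, $F:I\to\alpha(S^1)$ and $G:\Lambda\to\omega(S^1)$ surjective functions, $0$ a new symbol not in $S$, and $P$ a $\Lambda\times I$ matrix with entries in $S\cup\{0\}$ such that $\alpha(P_{\lambda i})=G(\lambda)$ and $\omega(P_{\lambda i})=F(i)$ whenever $P_{\lambda i}\neq 0$. The Rees matrix semigroup with zero $M^0(S;F(I),G(\Lambda);P)$ (the notation $F(I),G(\Lambda)$ is purely symbolic) has elements $\{0\}\cup\{(i,x,\lambda)\in I\times S\times\Lambda : F(i)=\alpha(x),\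 \omega(x)=G(\lambda)\}$, with $(i,x,\lambda)(j,y,\mu)=(i,xP_{\lambda j}y,\mu)$ if $P_{\lambda j}\ne 0$ and $=0$ otherwise, and $0m=m0=0$ for all $m$. Right-ideal-generation. A subset $T\subseteq S^1$ is weakly right-ideal-generated by a row cross-section of $P$ if there is a subset $\Lambda'\subseteq\Lambda$ such that $G$ restricts to a bijection $\Lambda'\to\omega(S^1)$ and every arrow in $T$ can be written in the form $P_{\lambda i}s$ or in the form $P_{\lambda i}$ for some $\lambda\in\Lambda'$, $i\in I$ (with $P_{\lambda i}\ne0$) and, where appropriate, $s\in S^1$. *)

theory Defs
  imports "Graph_Theory.Arc_Walk"
begin

section \<open>Semigroupoids\<close>

text \<open>
  The graph carries the objects (\<^const>\<open>verts\<close>), the arrows (\<^const>\<open>arcs\<close>), the source map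
  (\<^const>\<open>tail\<close>) and the target map (\<^const>\<open>head\<close>). The partial multiplication is a total
  HOL function whose values matter only on composable pairs of arrows. Multiplication is in
  diagrammatic order: the product of \<open>e\<close> and \<open>f\<close> requires \<open>head e = tail f\<close>.
\<close>

locale semigroupoid = wf_digraph S
  for S :: "('o, 's) pre_digraph" +
  fixes mult :: "'s \<Rightarrow> 's \<Rightarrow> 's"  (infixl "\<cdot>" 70)
  assumes mult_closed: "\<lbrakk>e \<in> arcs S; f \<in> arcs S; head S e = tail S f\<rbrakk> \<Longrightarrow> e \<cdot> f \<in> arcs S"
    and tail_mult: "\<lbrakk>e \<in> arcs S; f \<in> arcs S; head S e = tail S f\<rbrakk> \<Longrightarrow> tail S (e \<cdot> f) = tail S e"
    and head_mult: "\<lbrakk>e \<in> arcs S; f \<in> arcs S; head S e = tail S f\<rbrakk> \<Longrightarrow> head S (e \<cdot> f) = head S f"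
    and mult_assoc:
      "\<lbrakk>e \<in> arcs S; f \<in> arcs S; g \<in> arcs S; head S e = tail S f; head S f = tail S g\<rbrakk>
        \<Longrightarrow> e \<cdot> (f \<cdot> g) = (e \<cdot> f) \<cdot> g"

definition isolation_free :: "('o, 's) pre_digraph \<Rightarrow> bool" where
  "isolation_free S \<longleftrightarrow> (\<forall>v \<in> verts S. \<exists>e \<in> arcs S. tail S e = v \<or> head S e = v)"

definition identity_arrow :: "('o, 's) pre_digraph \<Rightarrow> ('s \<Rightarrow> 's \<Rightarrow> 's) \<Rightarrow> 's \<Rightarrow> bool" where
  "identity_arrow S mult e \<longleftrightarrow>
     e \<in> arcs S \<and> tail S e = head S e \<and>
     (\<forall>s \<in> arcs S. head S e = tail S s \<longrightarrow> mult e s = s) \<and>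
     (\<forall>t \<in> arcs S. head S t = tail S e \<longrightarrow> mult t e = t)"

definition semigroupoid_hom ::
  "('o, 's) pre_digraph \<Rightarrow> ('s \<Rightarrow> 's \<Rightarrow> 's) \<Rightarrow> ('p, 't) pre_digraph \<Rightarrow> ('t \<Rightarrow> 't \<Rightarrow> 't)
    \<Rightarrow> ('o \<Rightarrow> 'p) \<Rightarrow> ('s \<Rightarrow> 't) \<Rightarrow> bool" where
  "semigroupoid_hom S multS T multT \<phi> \<psi> \<longleftrightarrow>
     (\<forall>v \<in> verts S. \<phi> v \<in> verts T) \<and>
     (\<forall>e \<in> arcs S. \<psi> e \<in> arcs T \<and>
        tail T (\<psi> e) = \<phi> (tail S e) \<and> head T (\<psi> e) = \<phi> (head S e)) \<and>
     (\<forall>e \<in> arcs S. \<forall>f \<in> arcs S. head S e = tail S f \<longrightarrow>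
        \<psi> (multS e f) = multT (\<psi> e) (\<psi> f))"


section \<open>Paths and regularity\<close>

text \<open>
  Together with list concatenation as multiplication, \<open>path_graph X\<close> is the free semigroupoid
  on the graph \<open>X\<close>.
\<close>

definition path_graph :: "('v, 'e) pre_digraph \<Rightarrow> ('v, 'e list) pre_digraph" where
  "path_graph X =
     \<lparr> verts = verts X,
       arcs = {p. p \<noteq> [] \<and> (\<exists>u v. pre_digraph.awalk X u p v)},
       tail = (\<lambda>p. tail X (hd p)),
       head = (\<lambda>p. head X (last p)) \<rparr>"

text \<open>
  The language \<open>L\<close> is accepted by a complete deterministic finite automaton over the finite
  alphabet \<open>A\<close>. Taking states in \<^typ>\<open>nat\<close> is no restriction, since the state set is finite.
\<close>

definition regular_language :: "'a set \<Rightarrow> 'a list set \<Rightarrow> bool" where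
  "regular_language A L \<longleftrightarrow> finite A \<and>
     (\<exists>(Q :: nat set) q\<^sub>0 \<delta> Fin.
        finite Q \<and> q\<^sub>0 \<in> Q \<and> Fin \<subseteq> Q \<and> (\<forall>q \<in> Q. \<forall>a \<in> A. \<delta> q a \<in> Q) \<and>
        L = {w \<in> lists A. foldl \<delta> q\<^sub>0 w \<in> Fin})"

text \<open>\<open>Inr s\<close> is the padding loop at the vertex \<open>s\<close>.\<close>

definition padded_graph :: "('v, 'e) pre_digraph \<Rightarrow> ('v, 'e + 'v) pre_digraph" where
  "padded_graph X =
     \<lparr> verts = verts X,
       arcs = Inl ` arcs X \<union> Inr ` verts X,
       tail = case_sum (tail X) id,
       head = case_sum (head X) id \<rparr>"

definition product_graph ::
  "('v, 'e) pre_digraph \<Rightarrow> ('w, 'f) pre_digraph \<Rightarrow> ('v \<times> 'w, 'e \<times> 'f) pre_digraph" where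
  "product_graph X Y =
     \<lparr> verts = verts X \<times> verts Y,
       arcs = arcs X \<times> arcs Y,
       tail = map_prod (tail X) (tail Y),
       head = map_prod (head X) (head Y) \<rparr>"

definition pad_to :: "('v, 'e) pre_digraph \<Rightarrow> nat \<Rightarrow> 'e list \<Rightarrow> ('e + 'v) list" where
  "pad_to X n p = map Inl p @ replicate (n - length p) (Inr (head X (last p)))"

definition pad_pair ::
  "('v, 'e) pre_digraph \<Rightarrow> 'e list \<times> 'e list \<Rightarrow> (('e + 'v) \<times> ('e + 'v)) list" where
  "pad_pair X = (\<lambda>(a, b).
     zip (pad_to X (max (length a) (length b)) a) (pad_to X (max (length a) (length b)) b))"

definition synchronously_regular ::
  "('v, 'e) pre_digraph \<Rightarrow> ('e list \<times> 'e list) set \<Rightarrow> bool" where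
  "synchronously_regular X R \<longleftrightarrow>
     R \<subseteq> arcs (path_graph X) \<times> arcs (path_graph X) \<and>
     regular_language (arcs (product_graph (padded_graph X) (padded_graph X))) (pad_pair X ` R)"


section \<open>Automatic semigroupoids\<close>

definition choice_of_representatives ::
  "('o, 's) pre_digraph \<Rightarrow> ('s \<Rightarrow> 's \<Rightarrow> 's)
    \<Rightarrow> ('o, 'e) pre_digraph \<Rightarrow> 'e list set \<Rightarrow> ('e list \<Rightarrow> 's) \<Rightarrow> bool" where
  "choice_of_representatives S mult X K \<rho> \<longleftrightarrow>
     wf_digraph X \<and> verts X = verts S \<and>
     semigroupoid_hom (path_graph X) (@) S mult id \<rho> \<and>
     \<rho> ` arcs (path_graph X) = arcs S \<and>
     K \<subseteq> arcs (path_graph X) \<and> \<rho> ` K = arcs S"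

definition edge_relation ::
  "('o, 'e) pre_digraph \<Rightarrow> 'e list set \<Rightarrow> ('e list \<Rightarrow> 's) \<Rightarrow> 'e \<Rightarrow> ('e list \<times> 'e list) set" where
  "edge_relation X K \<rho> a =
     {(u, v). u \<in> K \<and> v \<in> K \<and> head (path_graph X) u = tail X a \<and> \<rho> (u @ [a]) = \<rho> v}"

definition vertex_relation ::
  "('o, 'e) pre_digraph \<Rightarrow> 'e list set \<Rightarrow> ('e list \<Rightarrow> 's) \<Rightarrow> 'o \<Rightarrow> ('e list \<times> 'e list) set" where
  "vertex_relation X K \<rho> x =
     {(u, v). u \<in> K \<and> v \<in> K \<and> head (path_graph X) u = x \<and> \<rho> u = \<rho> v}"

definition automatic_structure ::
  "('o, 's) pre_digraph \<Rightarrow> ('s \<Rightarrow> 's \<Rightarrow> 's)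
    \<Rightarrow> ('o, 'e) pre_digraph \<Rightarrow> 'e list set \<Rightarrow> ('e list \<Rightarrow> 's) \<Rightarrow> bool" where
  "automatic_structure S mult X K \<rho> \<longleftrightarrow>
     choice_of_representatives S mult X K \<rho> \<and> finite (arcs X) \<and>
     (\<forall>a \<in> arcs X. synchronously_regular X (edge_relation X K \<rho> a)) \<and>
     (\<forall>x \<in> verts X. synchronously_regular X (vertex_relation X K \<rho> x))"

text \<open>
  Since \<open>X\<close> has only finitely many edges, letting the edges range over \<^typ>\<open>nat\<close>
  is no restriction.
\<close>

definition automatic :: "('o, 's) pre_digraph \<Rightarrow> ('s \<Rightarrow> 's \<Rightarrow> 's) \<Rightarrow> bool" where
  "automatic S mult \<longleftrightarrow>
     (\<exists>(X :: ('o, nat) pre_digraph) K \<rho>. automatic_structure S mult X K \<rho>)"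


section \<open>Rees matrix semigroups with zero\<close>

text \<open>
  Matrix entries lie in \<^typ>\<open>'s option\<close>, and \<^const>\<open>None\<close> plays the role of the new symbol \<open>0\<close>,
  both in the matrix and in the Rees matrix semigroup.
\<close>

locale rees_matrix_data = semigroupoid S mult
  for S :: "('o, 's) pre_digraph" and mult :: "'s \<Rightarrow> 's \<Rightarrow> 's"  (infixl "\<cdot>" 70) +
  fixes I :: "'i set" and \<Lambda> :: "'l set"
    and F :: "'i \<Rightarrow> 'o" and G :: "'l \<Rightarrow> 'o"
    and P :: "'l \<Rightarrow> 'i \<Rightarrow> 's option"
  assumes nonempty: "arcs S \<noteq> {}"
    and isolation_free: "isolation_free S"
    and F_surj: "F ` I = tail S ` arcs S"
    and G_surj: "G ` \<Lambda> = head S ` arcs S"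
    and P_entry: "\<lbrakk>l \<in> \<Lambda>; i \<in> I; P l i = Some p\<rbrakk>
                   \<Longrightarrow> p \<in> arcs S \<and> tail S p = G l \<and> head S p = F i"

definition rees_elements ::
  "('o, 's) pre_digraph \<Rightarrow> 'i set \<Rightarrow> 'l set \<Rightarrow> ('i \<Rightarrow> 'o) \<Rightarrow> ('l \<Rightarrow> 'o)
    \<Rightarrow> ('i \<times> 's \<times> 'l) option set" where
  "rees_elements S I \<Lambda> F G =
     insert None {Some (i, x, l) | i x l.
       i \<in> I \<and> x \<in> arcs S \<and> l \<in> \<Lambda> \<and> F i = tail S x \<and> head S x = G l}"

fun rees_mult ::
  "('s \<Rightarrow> 's \<Rightarrow> 's) \<Rightarrow> ('l \<Rightarrow> 'i \<Rightarrow> 's option)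
    \<Rightarrow> ('i \<times> 's \<times> 'l) option \<Rightarrow> ('i \<times> 's \<times> 'l) option \<Rightarrow> ('i \<times> 's \<times> 'l) option" where
  "rees_mult mult P (Some (i, x, l)) (Some (j, y, m)) =
     (case P l j of None \<Rightarrow> None | Some p \<Rightarrow> Some (i, mult (mult x p) y, m))"
| "rees_mult mult P _ _ = None"

definition one_object_graph :: "'a set \<Rightarrow> (unit, 'a) pre_digraph" where
  "one_object_graph A = \<lparr> verts = {()}, arcs = A, tail = (\<lambda>_. ()), head = (\<lambda>_. ()) \<rparr>"

definition weakly_right_ideal_generated ::
  "('o, 's) pre_digraph \<Rightarrow> ('s \<Rightarrow> 's \<Rightarrow> 's) \<Rightarrow> 'i set \<Rightarrow> 'l set \<Rightarrow> ('l \<Rightarrow> 'o)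
    \<Rightarrow> ('l \<Rightarrow> 'i \<Rightarrow> 's option) \<Rightarrow> 's set \<Rightarrow> bool" where
  "weakly_right_ideal_generated S mult I \<Lambda> G P T \<longleftrightarrow>
     (\<exists>\<Lambda>' \<subseteq> \<Lambda>. bij_betw G \<Lambda>' (head S ` arcs S) \<and>
        (\<forall>t \<in> T. \<exists>l \<in> \<Lambda>'. \<exists>i \<in> I. \<exists>p. P l i = Some p \<and>
           (t = p \<or> (\<exists>s \<in> arcs S. head S p = tail S s \<and> t = mult p s))))"


section \<open>Well-formedness of the constructions\<close>

lemma path_graph_simps [simp]:
  "verts (path_graph X) = verts X"
  "tail (path_graph X) p = tail X (hd p)"
  "head (path_graph X) p = head X (last p)"
  by (simp_all add: path_graph_def)

lemma in_path_graph_iff: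
  assumes "wf_digraph X"
  shows "p \<in> arcs (path_graph X) \<longleftrightarrow>
    p \<noteq> [] \<and> pre_digraph.awalk X (tail X (hd p)) p (head X (last p))"
proof -
  interpret wf_digraph X by fact
  have "u = tail X (hd p) \<and> v = head X (last p)" if "awalk u p v" "p \<noteq> []" for u v
  proof -
    have "awhd u p = u" "awlast u p = v" using that(1) by auto
    then show ?thesis using that(2) by (auto simp: awalk_verts_conv hd_map split: if_splits)
  qed
  then show ?thesis by (auto simp: path_graph_def)
qed

lemma path_semigroupoid:
  assumes "wf_digraph X"
  shows "semigroupoid (path_graph X) (@)"
proof -
  interpret wf_digraph X by fact
  note iff = in_path_graph_iff[OF assms]
  show ?thesis
  proof
    fix p assume "p \<in> arcs (path_graph X)"
    then show "tail (path_graph X) p \<in> verts (path_graph X)"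
      and "head (path_graph X) p \<in> verts (path_graph X)"
      by (auto simp: iff)
  next
    fix p q assume "p \<in> arcs (path_graph X)" "q \<in> arcs (path_graph X)"
      and "head (path_graph X) p = tail (path_graph X) q"
    then show "p @ q \<in> arcs (path_graph X)"
      and "tail (path_graph X) (p @ q) = tail (path_graph X) p"
      and "head (path_graph X) (p @ q) = head (path_graph X) q"
      unfolding iff by (auto intro: awalk_appendI simp del: awalk_append_iff)
  qed simp
qed

lemma pad_pair_in_path_graph:
  assumes "wf_digraph X" and "a \<in> arcs (path_graph X)" and "b \<in> arcs (path_graph X)"
  shows "pad_pair X (a, b) \<in> arcs (path_graph (product_graph (padded_graph X) (padded_graph X)))"
proof -
  interpret wf_digraph X by fact
  let ?Y = "padded_graph X"
  let ?Z = "product_graph ?Y ?Y"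
  have loops: "pre_digraph.cas ?Y v (replicate n (Inr v)) v" for v n
    by (induction n) (auto simp: pre_digraph.cas.simps padded_graph_def)
  have pad: "pre_digraph.cas ?Y u (map Inl p @ replicate n (Inr v)) v" if "cas u p v" for u p v n
    using that
    by (induction p arbitrary: u)
      (auto simp: pre_digraph.cas.simps loops, auto simp: padded_graph_def)
  have zip_cas: "pre_digraph.cas ?Z (u, u') (zip p q) (v, v')"
    if "length p = length q" "pre_digraph.cas ?Y u p v" "pre_digraph.cas ?Y u' q v'"
    for u u' p q v v'
    using that
    by (induction p q arbitrary: u u' rule: list_induct2)
      (auto simp: pre_digraph.cas.simps, auto simp: product_graph_def)
  let ?n = "max (length a) (length b)"
  have a: "a \<noteq> []" "awalk (tail X (hd a)) a (head X (last a))"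
    and b: "b \<noteq> []" "awalk (tail X (hd b)) b (head X (last b))"
    using assms(2,3) by (simp_all add: in_path_graph_iff[OF assms(1)])
  have ends: "head X (last a) \<in> verts X" "head X (last b) \<in> verts X"
    using a b by auto
  have sets: "set (pad_to X ?n a) \<subseteq> arcs ?Y" "set (pad_to X ?n b) \<subseteq> arcs ?Y"
    using a b ends by (auto simp add: pad_to_def padded_graph_def awalk_def)
  have len: "length (pad_to X ?n a) = length (pad_to X ?n b)"
    by (simp add: pad_to_def)
  have "pre_digraph.cas ?Z (tail X (hd a), tail X (hd b)) (pad_pair X (a, b))
      (head X (last a), head X (last b))"
    unfolding pad_pair_def prod.case
    by (rule zip_cas[OF len]) (use a b in \<open>auto simp: pad_to_def awalk_def intro!: pad\<close>)
  moreover have "set (pad_pair X (a, b)) \<subseteq> arcs ?Z"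
  proof (rule subrelI)
    fix x y assume "(x, y) \<in> set (pad_pair X (a, b))"
    then have "x \<in> set (pad_to X ?n a)" "y \<in> set (pad_to X ?n b)"
      unfolding pad_pair_def prod.case by (blast dest: set_zip_leftD set_zip_rightD)+
    then show "(x, y) \<in> arcs ?Z"
      using sets by (auto simp: product_graph_def)
  qed
  moreover have "(tail X (hd a), tail X (hd b)) \<in> verts ?Z"
    using a b by (auto simp: product_graph_def padded_graph_def awalk_def)
  moreover have "pad_pair X (a, b) \<noteq> []"
    using a b by (cases a; cases b) (auto simp: pad_pair_def pad_to_def)
  ultimately show ?thesis
    unfolding path_graph_def pre_digraph.awalk_def by (simp del: split_paired_Ex) blast
qed

lemma (in rees_matrix_data) rees_semigroupoid:
  "semigroupoid (one_object_graph (rees_elements S I \<Lambda> F G)) (rees_mult mult P)"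
proof
  fix a b c
  assume ab: "a \<in> arcs (one_object_graph (rees_elements S I \<Lambda> F G))"
    "b \<in> arcs (one_object_graph (rees_elements S I \<Lambda> F G))"
  then show "rees_mult mult P a b \<in> arcs (one_object_graph (rees_elements S I \<Lambda> F G))"
    by (auto simp: one_object_graph_def rees_elements_def tail_mult head_mult mult_closed
        split: option.splits dest!: P_entry[rotated 2])
  assume "c \<in> arcs (one_object_graph (rees_elements S I \<Lambda> F G))"
  with ab show "rees_mult mult P a (rees_mult mult P b c) = rees_mult mult P (rees_mult mult P a b) c"
    by (auto simp: one_object_graph_def rees_elements_def mult_assoc tail_mult head_mult mult_closed
        split: option.splits dest!: P_entry[rotated 2])
qed (auto simp: one_object_graph_def)

end

theory Submission
  imports Defs "HOL-Library.Countable"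
begin

text \<open>
  Let \<open>(X, K, \<rho>)\<close> be an automatic structure for the Rees matrix semigroup. For each source \<open>v\<close> choose
  an index \<open>i\<^sub>v\<close> with \<open>F i\<^sub>v = v\<close>, and represent an arrow \<open>s\<close> of \<open>S\<close> by the words \<open>w a\<close> of value
  \<open>(i\<^sub>v, s, \<lambda>)\<close>, where \<open>s\<close> has source \<open>v\<close>, \<open>a\<close> is a letter, and \<open>w\<close> is empty or in \<open>K\<close>. If \<open>a\<close>
  has value \<open>(j, x, \<lambda>)\<close>, then \<open>s g\<close> is the middle coordinate of \<open>\<rho>(w) (j, x g, \<mu>)\<close>. So right
  multiplication by \<open>g\<close> in \<open>S\<close> becomes, for each of the finitely many last letters, right
  multiplication of \<open>w\<close> by a fixed element of the Rees matrix semigroup, which is synchronously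
  regular.

  To obtain paths over a graph on the objects of \<open>S\<close>, a word \<open>a\<^sub>1 \<dots> a\<^sub>n\<close> with
  \<open>\<rho>(a\<^sub>k) = (i\<^sub>k, x\<^sub>k, \<lambda>\<^sub>k)\<close> is rewritten with the same length: the first letter becomes the
  arrow \<open>x\<^sub>1\<close>, and each later letter becomes the arrow \<open>P x\<^sub>k\<close>, where \<open>P\<close> is the matrix entry at
  \<open>(\<lambda>\<^sub>k\<^sub>-\<^sub>1, i\<^sub>k)\<close>. All of these arrows exist if and only if the word has nonzero value, and
  keeping \<open>x\<^sub>1\<close> only when \<open>i\<^sub>1\<close> is one of the \<open>i\<^sub>v\<close> singles out the words wanted. Closure properties
  of regular languages are obtained from the criterion of Myhill and Nerode.
\<close>

section \<open>Languages with finitely many left quotients\<close>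

text \<open>Quotients by all words over the letter type, so that closure properties need no
  alphabet; \<open>regular_language_iff\<close> adds one.\<close>

definition finite_quotients :: "'a list set \<Rightarrow> bool" where
  "finite_quotients L \<longleftrightarrow> finite (range (\<lambda>u. {v. u @ v \<in> L}))"

text \<open>Here \<open>f u\<close> is the state of an automaton after reading \<open>u\<close>. The
  closure proofs below choose \<open>f\<close> as the data that a product or subset automaton would
  store.\<close>

lemma finite_quotients_factor:
  assumes "finite (range f)" and "\<And>u. {v. u @ v \<in> L} = g (f u)"
  shows "finite_quotients L"
proof -
  have "range (\<lambda>u. {v. u @ v \<in> L}) = g ` range f"
    using assms(2) by auto
  then show ?thesis
    using assms(1) by (simp add: finite_quotients_def)
qed

text \<open>The members of the family serve as states of an automaton, with quotients by single
  letters as transitions.\<close>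

lemma finite_quotients_Cons_closed:
  assumes "finite \<F>" and "L \<in> \<F>"
    and closed: "\<And>L x. L \<in> \<F> \<Longrightarrow> {v. x # v \<in> L} \<in> \<F>"
  shows "finite_quotients L"
proof -
  have "{v. u @ v \<in> L} \<in> \<F>" if "L \<in> \<F>" for u L
    using that
  proof (induction u arbitrary: L)
    case (Cons x u)
    then show ?case
      using Cons.IH[OF closed[OF Cons.prems, of x]] by simp
  qed simp
  then show ?thesis
    unfolding finite_quotients_def using assms(1,2) by (blast intro: finite_subset)
qed

section \<open>Closure under set operations, letter maps and padding\<close>

lemma finite_quotients_empty: "finite_quotients {}"
  by (simp add: finite_quotients_def)

lemma finite_quotients_Un:
  assumes "finite_quotients L" and "finite_quotients M"
  shows "finite_quotients (L \<union> M)"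
proof (rule finite_quotients_factor)
  have "range (\<lambda>u. ({v. u @ v \<in> L}, {v. u @ v \<in> M}))
      \<subseteq> range (\<lambda>u. {v. u @ v \<in> L}) \<times> range (\<lambda>u. {v. u @ v \<in> M})"
    by auto
  then show "finite (range (\<lambda>u. ({v. u @ v \<in> L}, {v. u @ v \<in> M})))"
    using assms unfolding finite_quotients_def by (blast intro: finite_subset)
  show "{v. u @ v \<in> L \<union> M} = (\<lambda>(A, B). A \<union> B) ({v. u @ v \<in> L}, {v. u @ v \<in> M})" for u
    by auto
qed

lemma finite_quotients_Int:
  assumes "finite_quotients L" and "finite_quotients M"
  shows "finite_quotients (L \<inter> M)"
proof (rule finite_quotients_factor)
  have "range (\<lambda>u. ({v. u @ v \<in> L}, {v. u @ v \<in> M}))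
      \<subseteq> range (\<lambda>u. {v. u @ v \<in> L}) \<times> range (\<lambda>u. {v. u @ v \<in> M})"
    by auto
  then show "finite (range (\<lambda>u. ({v. u @ v \<in> L}, {v. u @ v \<in> M})))"
    using assms unfolding finite_quotients_def by (blast intro: finite_subset)
  show "{v. u @ v \<in> L \<inter> M} = (\<lambda>(A, B). A \<inter> B) ({v. u @ v \<in> L}, {v. u @ v \<in> M})" for u
    by auto
qed

lemma finite_quotients_UN:
  assumes "finite J" and "\<And>j. j \<in> J \<Longrightarrow> finite_quotients (L j)"
  shows "finite_quotients (\<Union>j\<in>J. L j)"
  using assms by (induction J) (auto intro: finite_quotients_empty finite_quotients_Un)

lemma finite_quotients_map_vimage:
  assumes "finite_quotients L"
  shows "finite_quotients (map h -` L)"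
proof (rule finite_quotients_factor)
  show "finite (range (\<lambda>u. {v. map h u @ v \<in> L}))"
    using assms unfolding finite_quotients_def by (rule finite_subset[rotated]) auto
  show "{v. u @ v \<in> map h -` L} = map h -` {v. map h u @ v \<in> L}" for u
    by auto
qed

text \<open>Subset construction: the state after \<open>u\<close> is the set of quotients of
  \<open>L\<close> by all preimages of \<open>u\<close>.\<close>

lemma finite_quotients_map_image:
  assumes "finite_quotients L"
  shows "finite_quotients (map h ` L)"
proof (rule finite_quotients_factor)
  let ?f = "\<lambda>u. {{v. u' @ v \<in> L} | u'. map h u' = u}"
  have "range ?f \<subseteq> Pow (range (\<lambda>u. {v. u @ v \<in> L}))"
    by auto
  then show "finite (range ?f)"
    using assms unfolding finite_quotients_def by (blast intro: finite_subset)
  show "{v. u @ v \<in> map h ` L} = (\<lambda>\<A>. map h ` \<Union>\<A>) (?f u)" for u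
  proof (intro equalityI subsetI)
    fix v assume "v \<in> {v. u @ v \<in> map h ` L}"
    then obtain w where "w \<in> L" "u @ v = map h w" by auto
    then obtain u' v' where "w = u' @ v'" "u = map h u'" "v = map h v'"
      by (auto simp: append_eq_map_conv)
    with \<open>w \<in> L\<close> show "v \<in> (\<lambda>\<A>. map h ` \<Union>\<A>) (?f u)" by auto
  next
    fix v assume "v \<in> (\<lambda>\<A>. map h ` \<Union>\<A>) (?f u)"
    then obtain u' v' where "map h u' = u" "u' @ v' \<in> L" "v = map h v'" by auto
    then show "v \<in> {v. u @ v \<in> map h ` L}" by (auto intro!: image_eqI[of _ _ "u' @ v'"])
  qed
qed

lemma finite_quotients_strip:
  assumes "finite_quotients L"
  shows "finite_quotients {z. \<exists>k. z @ replicate k x \<in> L}"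
proof (rule finite_quotients_factor)
  show "finite (range (\<lambda>u. {v. u @ v \<in> L}))"
    using assms by (simp add: finite_quotients_def)
  show "{v. u @ v \<in> {z. \<exists>k. z @ replicate k x \<in> L}}
      = (\<lambda>A. {v. \<exists>k. v @ replicate k x \<in> A}) {v. u @ v \<in> L}" for u
    by auto
qed

text \<open>The quotient by \<open>u\<close> is determined by the quotient of \<open>L\<close> by
  \<open>u\<close> and one bit, which tells whether \<open>u\<close> is already a word of
  \<open>L\<close> followed by padding.\<close>

lemma finite_quotients_append_replicate:
  assumes "finite_quotients L"
  shows "finite_quotients {z @ replicate k x | z k. z \<in> L}"
proof (rule finite_quotients_factor)
  let ?X = "{replicate k x | k. True}"
  let ?f = "\<lambda>u. ({v. u @ v \<in> L}, \<exists>z\<in>L. \<exists>k. u = z @ replicate k x)"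
  have "range ?f \<subseteq> range (\<lambda>u. {v. u @ v \<in> L}) \<times> UNIV"
    by auto
  then show "finite (range ?f)"
    by (rule finite_subset) (use assms in \<open>simp add: finite_quotients_def\<close>)
  show "{v. u @ v \<in> {z @ replicate k x | z k. z \<in> L}}
      = (\<lambda>(A, b). {z @ replicate k x | z k. z \<in> A} \<union> (if b then ?X else {})) (?f u)" for u
  proof (intro equalityI subsetI)
    fix v assume "v \<in> {v. u @ v \<in> {z @ replicate k x | z k. z \<in> L}}"
    then obtain z k where z: "z \<in> L" "u @ v = z @ replicate k x" by auto
    \<comment> \<open>The end of \<open>u\<close> lies either in the padding or inside
      \<open>z\<close>.\<close>
    then consider y where "u = z @ y" "y @ v = replicate k x"
      | y where "z = u @ y" "v = y @ replicate k x"
      by (auto simp: append_eq_append_conv2)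
    then show "v \<in> (\<lambda>(A, b). {z @ replicate k x | z k. z \<in> A} \<union> (if b then ?X else {})) (?f u)"
    proof cases
      case 1
      then have "set (y @ v) \<subseteq> {x}" by auto
      then have "y = replicate (length y) x" "v = replicate (length v) x"
        by (auto intro!: replicate_eqI)
      with 1(1) z(1) show ?thesis by auto
    next
      case 2
      with z show ?thesis by auto
    qed
  next
    fix v assume "v \<in> (\<lambda>(A, b). {z @ replicate k x | z k. z \<in> A} \<union> (if b then ?X else {})) (?f u)"
    then consider z k where "u @ z \<in> L" "v = z @ replicate k x"
      | z k j where "z \<in> L" "u = z @ replicate k x" "v = replicate j x"
      by (auto split: if_splits)
    then show "v \<in> {v. u @ v \<in> {z @ replicate k x | z k. z \<in> L}}"
    proof cases
      case 1
      then have "u @ v = (u @ z) @ replicate k x" by simp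
      with 1(1) show ?thesis by blast
    next
      case 2
      then have "u @ v = z @ replicate (k + j) x" by (simp add: replicate_add)
      with 2 show ?thesis by blast
    qed
  qed
qed

section \<open>Two basic languages\<close>

lemma finite_quotients_lists: "finite_quotients (lists A)"
proof (rule finite_quotients_Cons_closed)
  show "{v. x # v \<in> L} \<in> {lists A, {}}" if "L \<in> {lists A, {}}" for L x
    using that by (cases "x \<in> A") auto
qed auto

lemma finite_quotients_singleton: "finite_quotients {w}"
proof (rule finite_quotients_Cons_closed)
  let ?\<F> = "insert {} ((\<lambda>n. {drop n w}) ` {..length w})"
  show "finite ?\<F>" by simp
  show "{w} \<in> ?\<F>" by (rule insertI2, rule image_eqI[of _ _ 0]) auto
  show "{v. x # v \<in> L} \<in> ?\<F>" if "L \<in> ?\<F>" for L x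
  proof (cases "\<exists>v. x # v \<in> L")
    case True
    then obtain n v where n: "n \<le> length w" "L = {drop n w}" "x # v = drop n w"
      using \<open>L \<in> ?\<F>\<close> by auto
    then have "v = drop (Suc n) w" "Suc n \<le> length w"
      by (metis drop_Suc list.sel(3) tl_drop, metis drop_all list.distinct(1) not_less_eq_eq)
    have "{v. x # v \<in> L} = {v}"
      by (auto simp: n(2) n(3)[symmetric])
    then have "{v. x # v \<in> L} = {drop (Suc n) w}"
      using \<open>v = drop (Suc n) w\<close> by simp
    with \<open>Suc n \<le> length w\<close> show ?thesis by blast
  qed simp
qed

text \<open>The theorem of Myhill and Nerode: the quotients of \<open>L\<close> are themselves the
  states of an automaton for \<open>L\<close>.\<close>

lemma regular_language_iff:
  "regular_language A L \<longleftrightarrow> finite A \<and> L \<subseteq> lists A \<and> finite_quotients L"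
proof (intro iffI conjI; (elim conjE)?)
  assume "regular_language A L"
  then obtain Q :: "nat set" and q\<^sub>0 \<delta> Fin where A: "finite A" and Q: "finite Q" "q\<^sub>0 \<in> Q"
    and \<delta>: "\<forall>q \<in> Q. \<forall>a \<in> A. \<delta> q a \<in> Q"
    and L: "L = {w \<in> lists A. foldl \<delta> q\<^sub>0 w \<in> Fin}"
    by (auto simp: regular_language_def)
  show "finite A" "L \<subseteq> lists A" using A L by auto
  have run: "foldl \<delta> q w \<in> Q" if "q \<in> Q" "w \<in> lists A" for q w
    using that(2,1) \<delta> by (induction w arbitrary: q) auto
  \<comment> \<open>The extra member \<open>{}\<close> is the quotient by a word that leaves the
    alphabet.\<close>
  have "{v. u @ v \<in> L} \<in> insert {} ((\<lambda>q. {v \<in> lists A. foldl \<delta> q v \<in> Fin}) ` Q)" for u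
  proof (cases "u \<in> lists A")
    case True
    then have "{v. u @ v \<in> L} = {v \<in> lists A. foldl \<delta> (foldl \<delta> q\<^sub>0 u) v \<in> Fin}"
      by (auto simp: L)
    with run[OF Q(2) True] show ?thesis by blast
  qed (auto simp: L)
  then have "range (\<lambda>u. {v. u @ v \<in> L})
      \<subseteq> insert {} ((\<lambda>q. {v \<in> lists A. foldl \<delta> q v \<in> Fin}) ` Q)"
    by blast
  then show "finite_quotients L"
    unfolding finite_quotients_def using Q(1) by (blast intro: finite_subset)
next
  assume A: "finite A" "L \<subseteq> lists A" and fin: "finite_quotients L"
  let ?\<Q> = "range (\<lambda>u. {v. u @ v \<in> L})"
  have "finite ?\<Q>" using fin by (simp add: finite_quotients_def)
  \<comment> \<open>States must be natural numbers, so quotients are numbered by \<open>f\<close>,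
    and the transition function decodes, takes a quotient and encodes again.\<close>
  then obtain f :: "'a list set \<Rightarrow> nat" where f: "inj_on f ?\<Q>"
    by (blast dest: finite_imp_inj_to_nat_seg)
  define \<delta> where "\<delta> q a = f {v. a # v \<in> inv_into ?\<Q> f q}" for q a
  have \<delta>: "\<delta> (f {v. u @ v \<in> L}) a = f {v. (u @ [a]) @ v \<in> L}" for u a
    unfolding \<delta>_def by (subst inv_into_f_f[OF f]) auto
  have run: "foldl \<delta> (f {v. u @ v \<in> L}) w = f {v. (u @ w) @ v \<in> L}" for u w
    by (induction w arbitrary: u) (simp_all add: \<delta> del: append_assoc, simp)
  have "f {v. w @ v \<in> L} \<in> f ` {M \<in> ?\<Q>. [] \<in> M} \<longleftrightarrow> w \<in> L" for w
    using inj_on_image_mem_iff[OF f, of "{v. w @ v \<in> L}" "{M \<in> ?\<Q>. [] \<in> M}"] by auto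
  with A(2) have "L = {w \<in> lists A. foldl \<delta> (f {v. [] @ v \<in> L}) w \<in> f ` {M \<in> ?\<Q>. [] \<in> M}}"
    unfolding run by auto
  moreover have "\<forall>q \<in> f ` ?\<Q>. \<forall>a \<in> A. \<delta> q a \<in> f ` ?\<Q>"
  proof (intro ballI)
    fix q a assume "q \<in> f ` ?\<Q>"
    then obtain u where "q = f {v. u @ v \<in> L}" by blast
    then show "\<delta> q a \<in> f ` ?\<Q>" unfolding \<open>q = _\<close> \<delta> by blast
  qed
  moreover have "finite (f ` ?\<Q>)" using \<open>finite ?\<Q>\<close> by blast
  moreover have "f {v. [] @ v \<in> L} \<in> f ` ?\<Q>" by blast
  moreover have "f ` {M \<in> ?\<Q>. [] \<in> M} \<subseteq> f ` ?\<Q>" by blast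
  ultimately show "regular_language A L"
    unfolding regular_language_def using A(1) by blast
qed


section \<open>Synchronously recognisable relations\<close>

definition pads :: "'a option list \<Rightarrow> 'a list \<Rightarrow> bool" where
  "pads w u \<longleftrightarrow> (\<exists>k. w = map Some u @ replicate k None)"

text \<open>Trailing columns \<open>(None, None)\<close> are allowed in any number. This slack lets
  relations whose words have different lengths be combined column by column.\<close>

definition padded_words :: "('a list \<times> 'b list) set \<Rightarrow> ('a option \<times> 'b option) list set" where
  "padded_words R = {z. \<exists>(u, v)\<in>R. pads (map fst z) u \<and> pads (map snd z) v}"

definition synchronous :: "('a list \<times> 'b list) set \<Rightarrow> bool" where
  "synchronous R \<longleftrightarrow> finite_quotients (padded_words R)"

text \<open>Truncated subtraction pads only the shorter word.\<close>

definition convolution :: "'a list \<Rightarrow> 'b list \<Rightarrow> ('a option \<times> 'b option) list" where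
  "convolution u v =
     zip (map Some u @ replicate (length v - length u) None)
         (map Some v @ replicate (length u - length v) None)"

lemma pads_unique:
  assumes "pads w u" and "pads w v"
  shows "u = v"
proof -
  \<comment> \<open>Erasing every \<open>None\<close> recovers the word.\<close>
  have "concat (map (\<lambda>x. case x of None \<Rightarrow> [] | Some a \<Rightarrow> [a]) w) = u" if "pads w u" for u
    using that by (auto simp: pads_def comp_def)
  with assms show ?thesis by metis
qed

lemma pads_Nil_iff [simp]: "pads [] u \<longleftrightarrow> u = []"
  by (auto simp: pads_def)

lemma pads_None_iff [simp]: "pads (None # w) u \<longleftrightarrow> u = [] \<and> pads w []"
  by (cases u) (auto simp: pads_def Cons_replicate_eq intro: exI[of _ "Suc _"])

lemma pads_Some_iff [simp]: "pads (Some a # w) u \<longleftrightarrow> (\<exists>u'. u = a # u' \<and> pads w u')"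
  by (cases u) (auto simp: pads_def Cons_replicate_eq)

lemma pads_ex: "length u \<le> n \<Longrightarrow> \<exists>w. length w = n \<and> pads w u"
  by (rule exI[of _ "map Some u @ replicate (n - length u) None"]) (auto simp: pads_def)

lemma pads_append_replicate [simp]: "pads (w @ replicate k None) u \<longleftrightarrow> pads w u"
proof (induction w arbitrary: u)
  case Nil
  show ?case by (induction k) auto
next
  case (Cons x w)
  then show ?case by (cases x) auto
qed

lemma padded_words_eq:
  "padded_words R = {z @ replicate k (None, None) | z k. z \<in> (\<lambda>(u, v). convolution u v) ` R}"
proof (intro equalityI subsetI)
  fix z assume "z \<in> padded_words R"
  then obtain u v k j where uv: "(u, v) \<in> R"
    and k: "map fst z = map Some u @ replicate k None"
    and j: "map snd z = map Some v @ replicate j None"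
    by (auto simp: padded_words_def pads_def)
  from arg_cong[OF k, of length] arg_cong[OF j, of length]
  have len: "length u + k = length v + j" by simp
  \<comment> \<open>The number of columns at the end in which both tracks are padded.\<close>
  define m where "m = min k j"
  have "replicate k (None :: 'a option) = replicate (length v - length u) None @ replicate m None"
    "replicate j (None :: 'b option) = replicate (length u - length v) None @ replicate m None"
    unfolding m_def replicate_add[symmetric] using len by (auto simp: min_def intro!: arg_cong2[where f = replicate])
  then have "zip (map fst z) (map snd z)
      = zip ((map Some u @ replicate (length v - length u) None) @ replicate m None)
          ((map Some v @ replicate (length u - length v) None) @ replicate m None)"
    unfolding k j by simp
  also have "\<dots> = convolution u v @ replicate m (None, None)"
    by (subst zip_append) (simp_all add: convolution_def)
  finally have "zip (map fst z) (map snd z) = convolution u v @ replicate m (None, None)" .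
  then have "z = convolution u v @ replicate m (None, None)" by (simp add: zip_map_fst_snd)
  with uv show "z \<in> {z @ replicate k (None, None) | z k. z \<in> (\<lambda>(u, v). convolution u v) ` R}" by blast
next
  fix z assume "z \<in> {z @ replicate k (None, None) | z k. z \<in> (\<lambda>(u, v). convolution u v) ` R}"
  then obtain u v k where "(u, v) \<in> R" "z = convolution u v @ replicate k (None, None)" by auto
  then show "z \<in> padded_words R"
    by (auto simp: padded_words_def convolution_def pads_def simp flip: replicate_add intro!: bexI[of _ "(u, v)"])
qed

lemma padding_not_in_convolution: "(None, None) \<notin> set (convolution u v)"
  by (auto simp: convolution_def in_set_conv_nth nth_append split: if_splits)

text \<open>A convolution never contains the column \<open>(None, None)\<close>, so forbidding this
  column removes exactly the surplus padding.\<close>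

lemma convolutions_eq:
  "(\<lambda>(u, v). convolution u v) ` R = padded_words R \<inter> lists (- {(None, None)})" (is "?C = _")
proof (intro equalityI subsetI)
  fix z assume "z \<in> ?C"
  moreover from this have "z \<in> lists (- {(None, None)})"
    using padding_not_in_convolution by (auto simp: in_lists_conv_set)
  moreover have "z = z @ replicate 0 (None, None)" by simp
  ultimately show "z \<in> padded_words R \<inter> lists (- {(None, None)})"
    unfolding padded_words_eq by blast
next
  fix z assume z: "z \<in> padded_words R \<inter> lists (- {(None, None)})"
  then obtain y k where y: "y \<in> ?C" "z = y @ replicate k (None, None)"
    unfolding padded_words_eq by blast
  with z have "k = 0" by (cases k) auto
  with y show "z \<in> ?C" by simp
qed

lemma synchronous_iff_convolution:
  "synchronous R \<longleftrightarrow> finite_quotients ((\<lambda>(u, v). convolution u v) ` R)"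
proof
  assume "synchronous R"
  then show "finite_quotients ((\<lambda>(u, v). convolution u v) ` R)"
    unfolding synchronous_def convolutions_eq
    by (intro finite_quotients_Int finite_quotients_lists)
next
  assume "finite_quotients ((\<lambda>(u, v). convolution u v) ` R)"
  then show "synchronous R"
    unfolding synchronous_def padded_words_eq by (rule finite_quotients_append_replicate)
qed

section \<open>Closure properties of synchronous relations\<close>

lemma synchronous_UN:
  assumes "finite J" and "\<And>j. j \<in> J \<Longrightarrow> synchronous (R j)"
  shows "synchronous (\<Union>j\<in>J. R j)"
proof -
  have "padded_words (\<Union>j\<in>J. R j) = (\<Union>j\<in>J. padded_words (R j))"
    by (auto simp: padded_words_def)
  with assms show ?thesis
    by (auto simp: synchronous_def intro: finite_quotients_UN)
qed

lemma synchronous_Un: "synchronous R \<Longrightarrow> synchronous T \<Longrightarrow> synchronous (R \<union> T)"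
  by (subst Un_eq_UN) (rule synchronous_UN, simp_all)

lemma synchronous_singleton: "synchronous {(u, v)}"
  by (simp add: synchronous_iff_convolution finite_quotients_singleton)

lemma synchronous_converse:
  assumes "synchronous R"
  shows "synchronous (R\<inverse>)"
proof -
  have "padded_words (R\<inverse>) = map prod.swap -` padded_words R"
    by (auto simp: padded_words_def comp_def)
  with assms show ?thesis
    by (simp add: synchronous_def finite_quotients_map_vimage)
qed

text \<open>
  The intermediate word may be longer than both outer words, so the projection of the three-track
  words to the outer tracks yields words of the composition with additional padding at the end.
\<close>

lemma synchronous_relcomp:
  fixes R :: "('a list \<times> 'b list) set" and T :: "('b list \<times> 'c list) set"
  assumes "synchronous R" and "synchronous T"
  shows "synchronous (R O T)"
proof -
  let ?M = "(map (\<lambda>t. (fst t, fst (snd t))) -` padded_words R)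
    \<inter> ((map snd :: ('a option \<times> _) list \<Rightarrow> _) -` padded_words T)"
  let ?L = "map (\<lambda>t. (fst t, snd (snd t))) ` ?M"
  have "padded_words (R O T) = {z. \<exists>k. z @ replicate k (None, None) \<in> ?L}"
  proof (intro equalityI subsetI)
    fix z assume "z \<in> padded_words (R O T)"
    then obtain u v x where R: "(u, v) \<in> R" and T: "(v, x) \<in> T"
      and z: "pads (map fst z) u" "pads (map snd z) x"
      by (auto simp: padded_words_def)
    \<comment> \<open>The added columns make room for the middle word \<open>v\<close>.\<close>
    define z' where "z' = z @ replicate (length v) (None, None)"
    have z': "pads (map fst z') u" "pads (map snd z') x"
      using z by (simp_all add: z'_def)
    obtain y where y: "length y = length z'" "pads y v"
      using pads_ex[of v "length z'"] by (auto simp: z'_def)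
    define w where "w = map2 (\<lambda>(a, c) b. (a, b, c)) z' y"
    have w: "map (\<lambda>t. (fst t, fst (snd t))) w = zip (map fst z') y"
      "map snd w = zip y (map snd z')"
      "map (\<lambda>t. (fst t, snd (snd t))) w = z'"
      using y(1)[symmetric] unfolding w_def by (induction z' y rule: list_induct2) auto
    have "zip (map fst z') y \<in> padded_words R" "zip y (map snd z') \<in> padded_words T"
      using R T y z' by (auto simp: padded_words_def)
    then have "w \<in> ?M" by (simp add: w del: map_map)
    then have "z' \<in> ?L" by (intro image_eqI[where x = w]) (rule w(3)[symmetric])
    then show "z \<in> {z. \<exists>k. z @ replicate k (None, None) \<in> ?L}"
      unfolding z'_def by blast
  next
    fix z assume "z \<in> {z. \<exists>k. z @ replicate k (None, None) \<in> ?L}"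
    then obtain k where "z @ replicate k (None, None) \<in> ?L" by (rule CollectE) (erule exE)
    then obtain w where z: "z @ replicate k (None, None) = map (\<lambda>t. (fst t, snd (snd t))) w"
      and w: "map (\<lambda>t. (fst t, fst (snd t))) w \<in> padded_words R" "map snd w \<in> padded_words T"
      by (elim imageE IntE vimageE) simp
    from w(1) obtain u v where R: "(u, v) \<in> R" and u: "pads (map fst w) u"
      and v: "pads (map (\<lambda>t. fst (snd t)) w) v"
      by (auto simp: padded_words_def comp_def)
    from w(2) obtain v' x where T: "(v', x) \<in> T" and v': "pads (map (\<lambda>t. fst (snd t)) w) v'"
      and x: "pads (map (\<lambda>t. snd (snd t)) w) x"
      by (auto simp: padded_words_def comp_def)
    \<comment> \<open>Both \<open>v\<close> and \<open>v'\<close> are read off the same middle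
      track, hence coincide.\<close>
    have "(u, x) \<in> R O T" using R T unfolding pads_unique[OF v v'] by (rule relcompI)
    moreover have "map fst z @ replicate k None = map fst w"
      "map snd z @ replicate k None = map (\<lambda>t. snd (snd t)) w"
      using arg_cong[OF z, of "map fst"] arg_cong[OF z, of "map snd"] by (simp_all add: comp_def)
    then have "pads (map fst z) u" "pads (map snd z) x"
      using u x pads_append_replicate[of "map fst z" k u] pads_append_replicate[of "map snd z" k x]
      by simp_all
    ultimately show "z \<in> padded_words (R O T)"
      by (auto simp: padded_words_def)
  qed
  moreover have "finite_quotients ?L"
    using assms by (intro finite_quotients_map_image finite_quotients_Int finite_quotients_map_vimage)
      (simp_all add: synchronous_def)
  ultimately show ?thesis
    by (simp add: synchronous_def finite_quotients_strip)
qed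

text \<open>The padding loops carry the end vertices of the paths, so this translation is one fixed
  letter map only on pairs with fixed ends. The converse translation forgets the vertices and needs
  no such restriction.\<close>

lemma pad_pair_conv_convolution:
  "pad_pair X (u, v) =
     map (map_prod (case_option (Inr (head X (last u))) Inl) (case_option (Inr (head X (last v))) Inl))
       (convolution u v)"
proof -
  have [simp]: "max m n - m = n - m" "max m n - n = m - n" for m n :: nat by simp_all
  show ?thesis
    by (simp add: pad_pair_def pad_to_def convolution_def map_prod_def comp_def flip: zip_map_map)
qed

lemma convolution_conv_pad_pair:
  "convolution u v =
     map (map_prod (case_sum Some (\<lambda>_. None)) (case_sum Some (\<lambda>_. None))) (pad_pair X (u, v))"
  unfolding pad_pair_conv_convolution
  by (auto simp: option.case_distrib intro!: map_idI[symmetric] split: option.splits)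

lemma synchronously_regular_imp_synchronous:
  assumes "synchronously_regular X R"
  shows "synchronous R"
proof -
  have "(\<lambda>(u, v). convolution u v) ` R
      = map (map_prod (case_sum Some (\<lambda>_. None)) (case_sum Some (\<lambda>_. None))) ` pad_pair X ` R"
    unfolding image_image by (intro image_cong) (auto simp: convolution_conv_pad_pair[of _ _ X])
  with assms show ?thesis
    by (auto simp: synchronously_regular_def regular_language_iff synchronous_iff_convolution
        intro: finite_quotients_map_image)
qed

text \<open>The pieces \<open>T j\<close> have constant end vertices, so on each of them the two
  kinds of padding differ by a single letter map.\<close>

lemma synchronously_regularI:
  assumes X: "wf_digraph X" "finite (arcs X)" "finite (verts X)"
    and R: "R \<subseteq> arcs (path_graph X) \<times> arcs (path_graph X)"
    and J: "finite J" "R = (\<Union>j\<in>J. T j)"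
    and T: "\<And>j. j \<in> J \<Longrightarrow> synchronous (T j)"
    and ends: "\<And>j u v. j \<in> J \<Longrightarrow> (u, v) \<in> T j \<Longrightarrow> head X (last u) = s j \<and> head X (last v) = t j"
  shows "synchronously_regular X R"
proof -
  have "finite_quotients (pad_pair X ` T j)" if "j \<in> J" for j
  proof -
    have "pad_pair X ` T j = map (map_prod (case_option (Inr (s j)) Inl) (case_option (Inr (t j)) Inl))
        ` (\<lambda>(u, v). convolution u v) ` T j"
      unfolding image_image
      by (intro image_cong refl) (auto simp: pad_pair_conv_convolution dest: ends[OF that])
    with T[OF that] show ?thesis
      by (auto simp: synchronous_iff_convolution intro: finite_quotients_map_image)
  qed
  then have "finite_quotients (pad_pair X ` R)"
    unfolding J(2) image_UN using J(1) by (rule finite_quotients_UN[rotated])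
  moreover have "pad_pair X ` R \<subseteq> lists (arcs (product_graph (padded_graph X) (padded_graph X)))"
  proof (intro image_subsetI)
    fix p assume "p \<in> R"
    then have "pad_pair X p \<in> arcs (path_graph (product_graph (padded_graph X) (padded_graph X)))"
      using R pad_pair_in_path_graph[OF X(1)] by (cases p) auto
    then show "pad_pair X p \<in> lists (arcs (product_graph (padded_graph X) (padded_graph X)))"
      by (auto simp: path_graph_def pre_digraph.awalk_def)
  qed
  moreover have "finite (arcs (product_graph (padded_graph X) (padded_graph X)))"
    using X by (simp add: product_graph_def padded_graph_def)
  ultimately show ?thesis
    using R by (simp add: synchronously_regular_def regular_language_iff)
qed


section \<open>Encoding words by their pairs of consecutive letters\<close>

text \<open>A letter is coded together with its predecessor because the matrix entry between them
  depends on both; \<open>q\<close> is the predecessor of the first letter, with \<open>None\<close>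
  at the beginning of a word.\<close>

primrec encode :: "nat option \<Rightarrow> nat list \<Rightarrow> nat list" where
  "encode q [] = []"
| "encode q (a # w) = to_nat (q, a) # encode (Some a) w"

lemma encode_snoc: "encode q (w @ [a]) = encode q w @ [to_nat (if w = [] then q else Some (last w), a)]"
  by (induction w arbitrary: q) auto

lemma encode_eq_Nil_iff [simp]: "encode q w = [] \<longleftrightarrow> w = []"
  by (cases w) auto

text \<open>It suffices to remember the last letter read. Finiteness of \<open>B\<close> bounds the
  letters that can occur, since each one is a component of a code in \<open>B\<close>.\<close>

lemma synchronous_encode_snoc:
  assumes "finite B"
  shows "synchronous {(w, encode q (w @ [a])) | w. set (encode q (w @ [a])) \<subseteq> B}"
proof -
  define L where "L q = padded_words {(w, encode q (w @ [a])) | w. set (encode q (w @ [a])) \<subseteq> B}" for q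
  define N where "N = padded_words {([] :: nat list, [] :: nat list)}"
  \<comment> \<open>\<open>L p\<close> is the state with previous letter \<open>p\<close>,
    \<open>N\<close> the state after the appended letter \<open>a\<close>, where only padding may
    follow, and \<open>{}\<close> the failure state.\<close>
  let ?\<F> = "{{}, N} \<union> L ` insert q ((\<lambda>n. Some (snd (from_nat n :: nat option \<times> nat))) ` B)"
  have L: "z \<in> L q \<longleftrightarrow> (\<exists>w. set (encode q (w @ [a])) \<subseteq> B \<and> pads (map fst z) w
      \<and> pads (map snd z) (encode q (w @ [a])))" for z q
    by (auto simp: L_def padded_words_def)
  have N: "z \<in> N \<longleftrightarrow> pads (map fst z) [] \<and> pads (map snd z) []" for z
    by (auto simp: N_def padded_words_def)
  have "(Some b, Some n) # z \<in> L q \<longleftrightarrow> n = to_nat (q, b) \<and> n \<in> B \<and> z \<in> L (Some b)" for q b n z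
  proof
    assume "n = to_nat (q, b) \<and> n \<in> B \<and> z \<in> L (Some b)"
    then obtain w where "set (encode q ((b # w) @ [a])) \<subseteq> B"
      "pads (map fst ((Some b, Some n) # z)) (b # w)"
      "pads (map snd ((Some b, Some n) # z)) (encode q ((b # w) @ [a]))"
      by (auto simp: L)
    then show "(Some b, Some n) # z \<in> L q"
      unfolding L by blast
  qed (fastforce simp: L)
  then have deriv_L: "{z. (Some b, Some n) # z \<in> L q} = (if n = to_nat (q, b) \<and> n \<in> B then L (Some b) else {})"
    for q b n
    by (cases "n = to_nat (q, b) \<and> n \<in> B") auto
  \<comment> \<open>A code above padding of the first track can only be that of the appended letter
    \<open>a\<close>. The second track cannot be padded yet.\<close>
  have deriv_L': "{z. (None, Some n) # z \<in> L q} = (if n = to_nat (q, a) \<and> n \<in> B then N else {})"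
    "{z. (x, None) # z \<in> L q} = {}" for q b n x
    by (auto simp: L N)
  have deriv_N: "{z. (x, y) # z \<in> N} = (if x = None \<and> y = None then N else {})" for x y
    by (cases x; cases y) (auto simp: N)
  have "finite_quotients (L q)"
  proof (rule finite_quotients_Cons_closed)
    show "finite ?\<F>" using assms by simp
    show "L q \<in> ?\<F>" by simp
    fix M and x :: "nat option \<times> nat option" assume M: "M \<in> ?\<F>"
    obtain x1 x2 where x: "x = (x1, x2)" by fastforce
    have L_case: "{z. x # z \<in> L p} \<in> ?\<F>" for p
    proof (cases x1; cases x2)
      fix b n assume "x1 = Some b" "x2 = Some n"
      then have "{z. x # z \<in> L p} = (if n = to_nat (p, b) \<and> n \<in> B then L (Some b) else {})"
        by (simp add: x deriv_L)
      moreover have "L (Some b) \<in> L ` (\<lambda>n. Some (snd (from_nat n :: nat option \<times> nat))) ` B"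
        if "n = to_nat (p, b)" "n \<in> B"
        using that by (intro imageI image_eqI[of _ _ n]) simp_all
      ultimately show ?thesis by (simp split: if_split) blast
    qed (auto simp: x deriv_L')
    have N_case: "{z. x # z \<in> N} \<in> ?\<F>"
      by (simp add: x deriv_N)
    consider "M = {}" | "M = N" | p where "M = L p"
      using M by blast
    then show "{z. x # z \<in> M} \<in> ?\<F>"
    proof cases
      case 1
      then show ?thesis by simp
    next
      case 2
      show ?thesis unfolding 2 by (rule N_case)
    next
      case 3
      show ?thesis unfolding 3 by (rule L_case)
    qed
  qed
  then show ?thesis
    by (simp add: synchronous_def L_def)
qed


section \<open>Evaluating paths in a semigroupoid\<close>

lemma (in wf_digraph) path_graph_append_iff:
  assumes "u \<noteq> []" and "v \<noteq> []"
  shows "u @ v \<in> arcs (path_graph G) \<longleftrightarrow>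
    u \<in> arcs (path_graph G) \<and> v \<in> arcs (path_graph G) \<and> head G (last u) = tail G (hd v)"
proof -
  have *: "awlast x u = head G (last u)" for x
    using assms(1) by (simp add: awalk_verts_conv)
  have **: "awalk x v y \<Longrightarrow> x = tail G (hd v)" for x y
    using assms(2) by (cases v) (auto simp: awalk_Cons_iff)
  show ?thesis
    using assms by (simp add: in_path_graph_iff[OF wf_digraph_axioms] *) (metis **)
qed

lemma (in wf_digraph) path_graph_singleton_iff: "[a] \<in> arcs (path_graph G) \<longleftrightarrow> a \<in> arcs G"
  by (auto simp: in_path_graph_iff[OF wf_digraph_axioms] awalk_Cons_iff awalk_Nil_iff)

text \<open>There is no empty product in a semigroupoid, so the fold starts from the first letter;
  the value at \<open>[]\<close> is irrelevant.\<close>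

definition path_value :: "('s \<Rightarrow> 's \<Rightarrow> 's) \<Rightarrow> ('e \<Rightarrow> 's) \<Rightarrow> 'e list \<Rightarrow> 's" where
  "path_value mult val w = foldl mult (val (hd w)) (map val (tl w))"

lemma path_value_singleton [simp]: "path_value mult val [a] = val a"
  by (simp add: path_value_def)

lemma path_value_snoc: "w \<noteq> [] \<Longrightarrow> path_value mult val (w @ [a]) = mult (path_value mult val w) (val a)"
  by (simp add: path_value_def)

text \<open>The universal property of the free semigroupoid on \<open>X\<close>. Induction adds
  letters on the right, matching the left fold, and each step uses associativity once.\<close>

lemma (in semigroupoid) path_value_hom:
  assumes X: "wf_digraph X" "verts X \<subseteq> verts S"
    and val: "\<And>a. a \<in> arcs X \<Longrightarrow> val a \<in> arcs S \<and> tail S (val a) = tail X a \<and> head S (val a) = head X a"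
  shows "semigroupoid_hom (path_graph X) (@) S mult id (path_value mult val)"
proof -
  interpret X: wf_digraph X by fact
  have arcs: "path_value mult val w \<in> arcs S \<and> tail S (path_value mult val w) = tail X (hd w)
      \<and> head S (path_value mult val w) = head X (last w)" if "w \<in> arcs (path_graph X)" for w
  proof -
    have "w \<noteq> []" using that by (simp add: path_graph_def)
    then show ?thesis
      using that
    proof (induction w rule: rev_nonempty_induct)
      case (single a)
      then show ?case using val by (simp add: X.path_graph_singleton_iff)
    next
      case (snoc a w)
      then show ?case
        using val by (simp add: X.path_graph_append_iff X.path_graph_singleton_iff path_value_snoc
            mult_closed tail_mult head_mult)
    qed
  qed
  have mult: "path_value mult val (u @ v) = path_value mult val u \<cdot> path_value mult val v"
    if "u \<in> arcs (path_graph X)" "v \<in> arcs (path_graph X)" "head X (last u) = tail X (hd v)" for u v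
  proof -
    have "u \<noteq> []" "v \<noteq> []" using that by (simp_all add: path_graph_def)
    from \<open>v \<noteq> []\<close> that(2,3) show ?thesis
    proof (induction v rule: rev_nonempty_induct)
      case (single a)
      then show ?case using \<open>u \<noteq> []\<close> by (simp add: path_value_snoc)
    next
      case (snoc a v)
      then have v: "v \<in> arcs (path_graph X)" "a \<in> arcs X" "head X (last v) = tail X a"
        "head X (last u) = tail X (hd v)"
        by (simp_all add: X.path_graph_append_iff X.path_graph_singleton_iff)
      have "path_value mult val (u @ v @ [a]) = path_value mult val (u @ v) \<cdot> val a"
        using \<open>u \<noteq> []\<close> path_value_snoc[of "u @ v"] by simp
      also have "\<dots> = path_value mult val u \<cdot> (path_value mult val v \<cdot> val a)"
        using snoc.IH v arcs[OF that(1)] arcs[OF v(1)] val[OF v(2)] by (simp add: mult_assoc)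
      finally show ?case
        using snoc.hyps by (simp add: path_value_snoc)
    qed
  qed
  show ?thesis
    using X(2) arcs mult by (auto simp: semigroupoid_hom_def)
qed


section \<open>Right multiplication in a Rees matrix semigroup\<close>

lemma in_path_graph_unit_iff:
  fixes X :: "(unit, 'e) pre_digraph"
  assumes "wf_digraph X" and "verts X = {()}"
  shows "w \<in> arcs (path_graph X) \<longleftrightarrow> w \<noteq> [] \<and> set w \<subseteq> arcs X"
proof -
  interpret wf_digraph X by fact
  have "cas u w v" for u v
    by (induction w arbitrary: u) auto
  then show ?thesis
    using assms(2) by (auto simp: in_path_graph_iff[OF assms(1)] awalk_def)
qed

locale automatic_rees = rees_matrix_data S mult I \<Lambda> F G P
  for S :: "('o, 's) pre_digraph" and mult :: "'s \<Rightarrow> 's \<Rightarrow> 's"  (infixl "\<cdot>" 70)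
    and I :: "'i set" and \<Lambda> :: "'l set" and F G P +
  fixes X :: "(unit, nat) pre_digraph" and K \<rho>
  assumes automatic_M:
    "automatic_structure (one_object_graph (rees_elements S I \<Lambda> F G)) (rees_mult mult P) X K \<rho>"
begin

section \<open>Representatives of elements of the Rees matrix semigroup\<close>

abbreviation M :: "('i \<times> 's \<times> 'l) option set" where
  "M \<equiv> rees_elements S I \<Lambda> F G"

abbreviation rmult  (infixl "\<odot>" 70) where
  "m \<odot> m' \<equiv> rees_mult mult P m m'"

lemma Some_in_M [simp]:
  "Some (i, x, l) \<in> M \<longleftrightarrow> i \<in> I \<and> x \<in> arcs S \<and> l \<in> \<Lambda> \<and> F i = tail S x \<and> head S x = G l"
  by (auto simp: rees_elements_def)

lemma rmult_closed: "a \<in> M \<Longrightarrow> b \<in> M \<Longrightarrow> a \<odot> b \<in> M"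
  using semigroupoid.mult_closed[OF rees_semigroupoid] by (simp add: one_object_graph_def)

lemma choice: "wf_digraph X" "verts X = {()}"
  "semigroupoid_hom (path_graph X) (@) (one_object_graph M) (rees_mult mult P) id \<rho>"
  "\<rho> ` arcs (path_graph X) = M" "K \<subseteq> arcs (path_graph X)" "\<rho> ` K = M"
  using automatic_M
  by (auto simp: automatic_structure_def choice_of_representatives_def one_object_graph_def)

lemma finite_X: "finite (arcs X)"
  using automatic_M by (simp add: automatic_structure_def)

lemma X_paths: "w \<in> arcs (path_graph X) \<longleftrightarrow> w \<noteq> [] \<and> set w \<subseteq> arcs X"
  using in_path_graph_unit_iff choice(1,2) .

lemma K_words: "w \<in> K \<Longrightarrow> w \<noteq> []" "w \<in> K \<Longrightarrow> set w \<subseteq> arcs X"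
  using choice(5) X_paths by blast+

lemma \<rho>_in_M: "w \<noteq> [] \<Longrightarrow> set w \<subseteq> arcs X \<Longrightarrow> \<rho> w \<in> M"
  using choice(4) X_paths by blast

lemma \<rho>_append:
  "\<lbrakk>u \<noteq> []; set u \<subseteq> arcs X; v \<noteq> []; set v \<subseteq> arcs X\<rbrakk> \<Longrightarrow> \<rho> (u @ v) = \<rho> u \<odot> \<rho> v"
  using choice(3) X_paths by (simp add: semigroupoid_hom_def)

lemma representative: "m \<in> M \<Longrightarrow> \<exists>w\<in>K. \<rho> w = m"
  using choice(6) by (metis imageE)

lemma synchronous_edge_relation: "a \<in> arcs X \<Longrightarrow> synchronous (edge_relation X K \<rho> a)"
  and synchronous_vertex_relation: "synchronous (vertex_relation X K \<rho> ())"
  using automatic_M choice(2)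
  by (auto simp: automatic_structure_def intro: synchronously_regular_imp_synchronous)

text \<open>The empty word acts as an adjoined identity, which \<rho> itself need not
  provide.\<close>

definition act :: "nat list \<Rightarrow> ('i \<times> 's \<times> 'l) option \<Rightarrow> ('i \<times> 's \<times> 'l) option" where
  "act u c = (if u = [] then c else \<rho> u \<odot> c)"

lemma act_generator:
  assumes "u = [] \<or> u \<in> K" and "a \<in> arcs X"
  shows "act u (\<rho> [a]) = \<rho> (u @ [a])"
  using assms K_words \<rho>_append[of u "[a]"] by (auto simp: act_def)

lemma act_in_M: "u = [] \<or> u \<in> K \<Longrightarrow> c \<in> M \<Longrightarrow> act u c \<in> M"
  using K_words \<rho>_in_M rmult_closed by (auto simp: act_def)

definition right_mult_relation :: "('i \<times> 's \<times> 'l) option \<Rightarrow> (nat list \<times> nat list) set" where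
  "right_mult_relation c = {(u, v). u \<in> insert [] K \<and> v \<in> K \<and> act u c = \<rho> v}"

text \<open>After each letter the product is replaced by a representative in \<open>K\<close>, so
  the relation is a composition of edge relations.\<close>

lemma synchronous_right_mult_word:
  assumes "w \<noteq> []" and "set w \<subseteq> arcs X"
  shows "synchronous {(u, v). u \<in> K \<and> v \<in> K \<and> \<rho> (u @ w) = \<rho> v}"
  using assms
proof (induction w rule: list_nonempty_induct)
  case (single a)
  then have "synchronous (edge_relation X K \<rho> a)"
    by (simp add: synchronous_edge_relation)
  moreover have "edge_relation X K \<rho> a = {(u, v). u \<in> K \<and> v \<in> K \<and> \<rho> (u @ [a]) = \<rho> v}"
    by (auto simp: edge_relation_def)
  ultimately show ?case by simp
next
  case (cons a w)
  let ?R = "\<lambda>w. {(u, v). u \<in> K \<and> v \<in> K \<and> \<rho> (u @ w) = \<rho> v}"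
  have *: "\<rho> (u @ a # w) = \<rho> (v @ w)" if "u \<in> K" "v \<in> K" "\<rho> (u @ [a]) = \<rho> v" for u v
    using that cons.prems cons.hyps K_words \<rho>_append[of "u @ [a]" w] \<rho>_append[of v w] by simp
  have "?R (a # w) = edge_relation X K \<rho> a O ?R w"
  proof (intro equalityI subrelI)
    fix u v assume uv: "(u, v) \<in> ?R (a # w)"
    then have "\<rho> (u @ [a]) \<in> M" using cons.prems K_words by (intro \<rho>_in_M) auto
    then obtain v' where "v' \<in> K" "\<rho> (u @ [a]) = \<rho> v'" using representative by metis
    then show "(u, v) \<in> edge_relation X K \<rho> a O ?R w"
      using uv *[of u v'] by (intro relcompI[of u v']) (auto simp: edge_relation_def)
  next
    fix u v assume "(u, v) \<in> edge_relation X K \<rho> a O ?R w"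
    then obtain v' where "(u, v') \<in> edge_relation X K \<rho> a" "(v', v) \<in> ?R w" by blast
    then show "(u, v) \<in> ?R (a # w)"
      using *[of u v'] by (simp add: edge_relation_def)
  qed
  moreover have "synchronous (edge_relation X K \<rho> a)"
    using cons.prems by (simp add: synchronous_edge_relation)
  ultimately show ?case
    using cons by (simp add: synchronous_relcomp)
qed

lemma synchronous_right_mult:
  assumes "c \<in> M"
  shows "synchronous (right_mult_relation c)"
proof -
  obtain w where w: "w \<in> K" "\<rho> w = c"
    using representative[OF assms] by blast
  \<comment> \<open>The second part covers \<open>u = []\<close>: all words of \<open>K\<close> with
    the same value as \<open>w\<close>.\<close>
  have "right_mult_relation c
      = {(u, v). u \<in> K \<and> v \<in> K \<and> \<rho> (u @ w) = \<rho> v} \<union> {([], w)} O vertex_relation X K \<rho> ()"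
    using w K_words \<rho>_append[of _ w]
    by (auto simp: right_mult_relation_def act_def vertex_relation_def)
  then show ?thesis
    using w(1) K_words
    by (simp add: synchronous_Un synchronous_relcomp synchronous_singleton synchronous_vertex_relation
        synchronous_right_mult_word)
qed


section \<open>The automatic structure for the semigroupoid\<close>

definition first_index :: "'o \<Rightarrow> 'i" where
  "first_index v = inv_into I F v"

lemma first_index: "x \<in> arcs S \<Longrightarrow> first_index (tail S x) \<in> I \<and> F (first_index (tail S x)) = tail S x"
  using F_surj by (metis first_index_def f_inv_into_f imageI inv_into_into)

text \<open>\<open>None\<close> marks an absent edge: a zero letter, a zero matrix entry, or an
  initial letter whose first index is not the chosen one for its source.\<close>

definition letter_value :: "nat option \<Rightarrow> nat \<Rightarrow> 's option" where
  "letter_value q b = (case \<rho> [b] of None \<Rightarrow> None | Some (j, y, m) \<Rightarrow>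
     (case q of
        None \<Rightarrow> if j = first_index (F j) then Some y else None
      | Some a \<Rightarrow> (case \<rho> [a] of None \<Rightarrow> None | Some (i, x, l) \<Rightarrow> map_option (\<lambda>p. p \<cdot> y) (P l j))))"

definition edge_value :: "nat \<Rightarrow> 's" where
  "edge_value n = the (case_prod letter_value (from_nat n))"

text \<open>Edges compose whenever their values in \<open>S\<close> do, so a path need not be an
  encoded word; only the words of \<open>L\<close> below are required to be.\<close>

definition Y :: "('o, nat) pre_digraph" where
  "Y = \<lparr> verts = verts S,
         arcs = {to_nat (q, b) | q b. q \<in> insert None (Some ` arcs X) \<and> b \<in> arcs X \<and> letter_value q b \<noteq> None},
         tail = (\<lambda>n. tail S (edge_value n)),
         head = (\<lambda>n. head S (edge_value n)) \<rparr>"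

definition L :: "nat list set" where
  "L = {encode None (w @ [a]) | w a. (w = [] \<or> w \<in> K) \<and> a \<in> arcs X \<and> set (encode None (w @ [a])) \<subseteq> arcs Y}"

definition evaluate :: "nat list \<Rightarrow> 's" where
  "evaluate = path_value mult edge_value"

lemma Y_simps [simp]:
  "verts Y = verts S" "tail Y n = tail S (edge_value n)" "head Y n = head S (edge_value n)"
  by (simp_all add: Y_def)

lemma in_arcs_Y_iff [simp]:
  "to_nat (q, b) \<in> arcs Y \<longleftrightarrow>
    q \<in> insert None (Some ` arcs X) \<and> b \<in> arcs X \<and> letter_value q b \<noteq> None"
  by (auto simp: Y_def)

lemma edge_value_to_nat [simp]: "edge_value (to_nat (q, b)) = the (letter_value q b)"
  by (simp add: edge_value_def)

lemma \<rho>_letter_in_M: "a \<in> arcs X \<Longrightarrow> \<rho> [a] \<in> M"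
  by (rule \<rho>_in_M) auto

lemma letter_value_in_arcs:
  assumes "q \<in> insert None (Some ` arcs X)" and "b \<in> arcs X" and "letter_value q b = Some s"
  shows "s \<in> arcs S"
proof -
  obtain j y m where y: "\<rho> [b] = Some (j, y, m)"
    using assms(3) by (auto simp: letter_value_def split: option.splits)
  with \<rho>_letter_in_M[OF assms(2)] have jy: "j \<in> I" "y \<in> arcs S" "F j = tail S y" by simp_all
  show ?thesis
  proof (cases q)
    case None
    then show ?thesis using assms(3) y jy by (simp add: letter_value_def split: if_splits)
  next
    case (Some a)
    then obtain i x l p where x: "\<rho> [a] = Some (i, x, l)" and p: "P l j = Some p" "s = p \<cdot> y"
      using assms(3) y by (auto simp: letter_value_def split: option.splits)
    have "l \<in> \<Lambda>" using \<rho>_letter_in_M[of a] assms(1) Some x by auto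
    with P_entry[OF _ jy(1) p(1)] show ?thesis using p(2) jy by (simp add: mult_closed)
  qed
qed

lemma edge_value_in_arcs:
  assumes "n \<in> arcs Y"
  shows "edge_value n \<in> arcs S"
proof -
  obtain q b s where "n = to_nat (q, b)" "q \<in> insert None (Some ` arcs X)" "b \<in> arcs X"
    "letter_value q b = Some s"
    using assms by (auto simp: Y_def)
  then show ?thesis using letter_value_in_arcs by simp
qed

lemma wf_Y: "wf_digraph Y"
  by unfold_locales (simp_all add: edge_value_in_arcs)

sublocale Y: wf_digraph Y
  by (rule wf_Y)

lemma finite_arcs_Y: "finite (arcs Y)"
proof -
  have "arcs Y \<subseteq> (\<lambda>(q, b). to_nat (q, b)) ` (insert None (Some ` arcs X) \<times> arcs X)"
    by (auto simp: Y_def)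
  then show ?thesis
    by (rule finite_subset) (simp add: finite_X)
qed

lemma evaluate_hom: "semigroupoid_hom (path_graph Y) (@) S mult id evaluate"
  unfolding evaluate_def by (rule path_value_hom) (simp_all add: wf_Y edge_value_in_arcs)

lemma evaluate_path:
  assumes "p \<in> arcs (path_graph Y)"
  shows "evaluate p \<in> arcs S" "tail S (evaluate p) = tail Y (hd p)" "head S (evaluate p) = head Y (last p)"
  using evaluate_hom assms by (simp_all add: semigroupoid_hom_def)

text \<open>The final conjunct strengthens the induction: a code sees only the previous letter,
  whereas the product uses the last coordinate of the whole prefix, and the two coordinates
  agree.\<close>

lemma encode_correct:
  assumes "w \<noteq> []" and "set w \<subseteq> arcs X"
  shows "(set (encode None w) \<subseteq> arcs Y \<longleftrightarrow> (\<exists>i s l. \<rho> w = Some (i, s, l) \<and> i = first_index (F i))) \<and>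
    (\<forall>i s l. \<rho> w = Some (i, s, l) \<and> i = first_index (F i) \<longrightarrow>
      encode None w \<in> arcs (path_graph Y) \<and> evaluate (encode None w) = s \<and>
      (\<exists>j x. \<rho> [last w] = Some (j, x, l)))"
  using assms
proof (induction w rule: rev_nonempty_induct)
  case (single a)
  then show ?case
    by (cases "\<rho> [a]") (auto simp: letter_value_def evaluate_def Y.path_graph_singleton_iff split: if_splits)
next
  case (snoc b w)
  let ?n = "to_nat (Some (last w), b)"
  have enc: "encode None (w @ [b]) = encode None w @ [?n]"
    using snoc.hyps by (simp add: encode_snoc)
  have w: "last w \<in> arcs X" "b \<in> arcs X" "set w \<subseteq> arcs X" using snoc.hyps snoc.prems by auto
  have \<rho>: "\<rho> (w @ [b]) = \<rho> w \<odot> \<rho> [b]"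
    using snoc.hyps w by (simp add: \<rho>_append)
  have IH: "set (encode None w) \<subseteq> arcs Y \<longleftrightarrow> (\<exists>i s l. \<rho> w = Some (i, s, l) \<and> i = first_index (F i))"
    using snoc.IH[OF w(3)] by blast
  have IH': "encode None w \<in> arcs (path_graph Y)" "evaluate (encode None w) = s"
      "\<exists>j x. \<rho> [last w] = Some (j, x, l)"
    if "\<rho> w = Some (i, s, l)" "i = first_index (F i)" for i s l
    using snoc.IH[OF w(3)] that by blast+
  show ?case
  proof (cases "set (encode None w) \<subseteq> arcs Y")
    case False
    \<comment> \<open>A nonzero product has a nonzero prefix with the same first index.\<close>
    have "\<not> (\<exists>i s l. \<rho> (w @ [b]) = Some (i, s, l) \<and> i = first_index (F i))"
    proof (intro notI, elim exE conjE)
      fix i s l assume "\<rho> (w @ [b]) = Some (i, s, l)" "i = first_index (F i)"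
      then have "\<exists>x k. \<rho> w = Some (i, x, k)"
        unfolding \<rho> using snoc.hyps by (cases "\<rho> w"; cases "\<rho> [b]") (auto split: option.splits)
      with \<open>i = first_index (F i)\<close> show False using IH False by blast
    qed
    with False show ?thesis by (simp add: enc) blast
  next
    case True
    then obtain i s l where s: "\<rho> w = Some (i, s, l)" "i = first_index (F i)"
      using IH by blast
    note IH' = IH'[OF s]
    obtain j' x where x: "\<rho> [last w] = Some (j', x, l)" using IH'(3) by blast
    show ?thesis
    proof (cases "\<rho> (w @ [b])")
      case None
      then have "letter_value (Some (last w)) b = None"
        using s(1) x unfolding \<rho> by (auto simp: letter_value_def split: option.splits)
      with None show ?thesis by (simp add: enc)
    next
      case (Some t)
      then obtain j y m p where y: "\<rho> [b] = Some (j, y, m)" and p: "P l j = Some p"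
        and t: "t = (i, s \<cdot> p \<cdot> y, m)"
        using s(1) unfolding \<rho> by (cases "\<rho> [b]") (auto split: option.splits)
      have lv: "letter_value (Some (last w)) b = Some (p \<cdot> y)"
        by (simp add: letter_value_def x y p)
      have in_S: "y \<in> arcs S" "F j = tail S y" "s \<in> arcs S" "head S s = G l" "j \<in> I" "l \<in> \<Lambda>"
        using \<rho>_letter_in_M[OF w(2)] \<rho>_in_M[OF snoc.hyps w(3)] y s(1) by simp_all
      note p' = P_entry[OF in_S(6,5) p]
      have n: "?n \<in> arcs Y" using w lv by simp
      \<comment> \<open>The new edge has value \<open>p \<cdot> y\<close>, which starts at
        \<open>G l\<close>, the target of \<open>s\<close>.\<close>
      have "head Y (last (encode None w)) = tail Y ?n"
        using evaluate_path(3)[OF IH'(1)] IH'(2) in_S p' lv by (simp add: tail_mult)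
      then have path: "encode None (w @ [b]) \<in> arcs (path_graph Y)"
        unfolding enc using IH'(1) n snoc.hyps
        by (simp add: Y.path_graph_append_iff Y.path_graph_singleton_iff)
      have "evaluate (encode None (w @ [b])) = s \<cdot> (p \<cdot> y)"
        unfolding enc evaluate_def using snoc.hyps IH'(2) lv by (simp add: path_value_snoc evaluate_def)
      also have "\<dots> = s \<cdot> p \<cdot> y"
        using in_S p' by (simp add: mult_assoc)
      finally show ?thesis
        using Some t True n path y s(2) by (simp add: enc)
    qed
  qed
qed


text \<open>Every object is an end of some arrow \<open>s\<close>. In a word of value
  \<open>(i, s, l)\<close> the first letter carries \<open>i\<close> and the last one
  \<open>l\<close>, so finitely many letters account for all ends.\<close>

lemma finite_verts_S: "finite (verts S)"
proof -
  let ?ends = "\<lambda>a. case \<rho> [a] of None \<Rightarrow> {} | Some (i, x, l) \<Rightarrow> {F i, G l}"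
  have fst: "\<exists>x l. \<rho> [hd w] = Some (i, x, l)"
    if "w \<noteq> []" "set w \<subseteq> arcs X" "\<rho> w = Some (i, s, m)" for w i s m
  proof (cases "tl w = []")
    case True
    with that have "w = [hd w]" by (cases w) auto
    with that(3) show ?thesis by metis
  next
    case False
    have "w = [hd w] @ tl w" using that(1) by simp
    moreover have "hd w \<in> arcs X" "set (tl w) \<subseteq> arcs X" using that(1,2) by (cases w; auto)+
    ultimately have "\<rho> w = \<rho> [hd w] \<odot> \<rho> (tl w)"
      using False \<rho>_append[of "[hd w]" "tl w"] by simp
    then show ?thesis
      using that(3) by (cases "\<rho> [hd w]"; cases "\<rho> (tl w)") (auto split: option.splits)
  qed
  have lst: "\<exists>i x. \<rho> [last w] = Some (i, x, m)"
    if "w \<noteq> []" "set w \<subseteq> arcs X" "\<rho> w = Some (i, s, m)" for w i s m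
  proof (cases "butlast w = []")
    case True
    with that have "w = [last w]" by (cases w) (auto split: if_splits)
    with that(3) show ?thesis by metis
  next
    case False
    have "w = butlast w @ [last w]" using that(1) by simp
    moreover have "last w \<in> arcs X" "set (butlast w) \<subseteq> arcs X"
      using that(1,2) by (auto dest: in_set_butlastD)
    ultimately have "\<rho> w = \<rho> (butlast w) \<odot> \<rho> [last w]"
      using False \<rho>_append[of "butlast w" "[last w]"] by simp
    then show ?thesis
      using that(3) by (cases "\<rho> (butlast w)"; cases "\<rho> [last w]") (auto split: option.splits)
  qed
  have "verts S \<subseteq> (\<Union>a\<in>arcs X. ?ends a)"
  proof
    fix v assume "v \<in> verts S"
    then obtain s where s: "s \<in> arcs S" "tail S s = v \<or> head S s = v"
      using isolation_free unfolding isolation_free_def by blast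
    obtain l where l: "l \<in> \<Lambda>" "G l = head S s" using G_surj s(1) by (metis imageE imageI)
    have "Some (first_index (tail S s), s, l) \<in> M"
      using s(1) l first_index by simp
    then obtain w where w: "w \<in> K" "\<rho> w = Some (first_index (tail S s), s, l)"
      using representative by blast
    have "F (first_index (tail S s)) = tail S s" using s(1) first_index by blast
    then have "tail S s \<in> ?ends (hd w)" "head S s \<in> ?ends (last w)"
      using fst[OF _ _ w(2)] lst[OF _ _ w(2)] w(1) K_words l(2) by fastforce+
    moreover have "hd w \<in> arcs X" "last w \<in> arcs X" using w(1) K_words by (auto simp: subset_iff)
    ultimately show "v \<in> (\<Union>a\<in>arcs X. ?ends a)" using s(2) by blast
  qed
  moreover have "finite (\<Union>a\<in>arcs X. ?ends a)"
    using finite_X by (auto split: option.splits)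
  ultimately show ?thesis by (rule finite_subset)
qed

text \<open>The first index is determined by the source of the evaluated arrow and the last
  coordinate by the letter \<open>a\<close>. Hence, for a fixed last letter, arrow and element of
  \<open>M\<close> determine each other.\<close>

lemma L_elem:
  assumes "w = [] \<or> w \<in> K" and "a \<in> arcs X" and "set (encode None (w @ [a])) \<subseteq> arcs Y"
  obtains i j x l where "act w (\<rho> [a]) = Some (i, evaluate (encode None (w @ [a])), l)"
    and "i = first_index (tail S (evaluate (encode None (w @ [a]))))"
    and "\<rho> [a] = Some (j, x, l)"
    and "head S x = head S (evaluate (encode None (w @ [a])))"
    and "encode None (w @ [a]) \<in> arcs (path_graph Y)"
proof -
  have w: "w @ [a] \<noteq> []" "set (w @ [a]) \<subseteq> arcs X" using assms(1,2) K_words by auto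
  note enc = encode_correct[OF w]
  obtain i s l where s: "\<rho> (w @ [a]) = Some (i, s, l)" "i = first_index (F i)"
    using assms(3) enc by blast
  with enc obtain j x where x: "encode None (w @ [a]) \<in> arcs (path_graph Y)"
    "evaluate (encode None (w @ [a])) = s" "\<rho> [a] = Some (j, x, l)"
    by auto
  have "Some (i, s, l) \<in> M" "Some (j, x, l) \<in> M"
    using \<rho>_in_M[OF w] \<rho>_letter_in_M[OF assms(2)] s(1) x(3) by simp_all
  then show thesis
    using that[of i l j x] s x act_generator[OF assms(1,2)] by simp
qed

lemma L_subset: "L \<subseteq> arcs (path_graph Y)"
proof
  fix p assume "p \<in> L"
  then obtain w a where "w = [] \<or> w \<in> K" "a \<in> arcs X" "set (encode None (w @ [a])) \<subseteq> arcs Y"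
    and p: "p = encode None (w @ [a])"
    unfolding L_def by blast
  then show "p \<in> arcs (path_graph Y)" unfolding p by (elim L_elem)
qed

lemma evaluate_L: "evaluate ` L = arcs S"
proof (intro equalityI subsetI)
  fix s assume "s \<in> evaluate ` L"
  then show "s \<in> arcs S" using L_subset evaluate_path(1) by blast
next
  fix s assume s: "s \<in> arcs S"
  obtain l where l: "l \<in> \<Lambda>" "G l = head S s" using G_surj s by (metis imageE imageI)
  let ?m = "Some (first_index (tail S s), s, l)"
  have "?m \<in> M" using s l first_index by simp
  then obtain u where u: "u \<in> K" "\<rho> u = ?m" using representative by blast
  then obtain w' a where wa: "u = w' @ [a]" using K_words(1) by (metis rev_exhaust)
  have a: "a \<in> arcs X" and w': "set w' \<subseteq> arcs X" using K_words(2)[OF u(1)] wa by auto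
  \<comment> \<open>The word left after removing the last letter need not lie in \<open>K\<close>,
    so it is exchanged for a word of \<open>K\<close> with the same value.\<close>
  obtain w where w: "w = [] \<or> w \<in> K" "\<rho> (w @ [a]) = ?m"
  proof (cases "w' = []")
    case True
    then show thesis using that[of "[]"] u(2) wa by simp
  next
    case False
    then obtain w where w: "w \<in> K" "\<rho> w = \<rho> w'"
      using representative \<rho>_in_M[OF False w'] by blast
    then have "\<rho> (w @ [a]) = \<rho> (w' @ [a])"
      using False a w' K_words by (simp add: \<rho>_append)
    with w(1) show thesis using that[of w] u(2) wa by simp
  qed
  have "w @ [a] \<noteq> []" "set (w @ [a]) \<subseteq> arcs X" using w(1) a K_words by auto
  note enc = encode_correct[OF this]
  have "F (first_index (tail S s)) = tail S s" using s first_index by blast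
  then have "set (encode None (w @ [a])) \<subseteq> arcs Y" "evaluate (encode None (w @ [a])) = s"
    using enc w(2) by auto
  then show "s \<in> evaluate ` L"
    using w(1) a unfolding L_def by blast
qed

text \<open>The map \<open>r\<close> stands for right multiplication by an arrow or for the identity
  map. It commutes with left multiplication, so it can be applied to the last factor alone.\<close>

lemma act_translate:
  assumes r_mult: "\<And>x y. \<lbrakk>x \<in> arcs S; y \<in> arcs S; head S x = tail S y; head S y = v\<rbrakk>
      \<Longrightarrow> r (x \<cdot> y) = x \<cdot> r y"
    and w: "w = [] \<or> w \<in> K" and x: "Some (j, x, l) \<in> M" "head S x = v"
    and act: "act w (Some (j, x, l)) = Some (i, s, l)"
  shows "act w (Some (j, r x, m)) = Some (i, r s, m)"
proof (cases "w = []")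
  case True
  then show ?thesis using act by (simp add: act_def)
next
  case False
  then obtain y k p where y: "\<rho> w = Some (i, y, k)" and p: "P k j = Some p" and s: "s = y \<cdot> p \<cdot> x"
    using act by (cases "\<rho> w") (auto simp: act_def split: option.splits)
  have y': "y \<in> arcs S" "head S y = G k" "k \<in> \<Lambda>"
    using y w False K_words \<rho>_in_M[of w] by auto
  have "p \<in> arcs S \<and> tail S p = G k \<and> head S p = F j"
    using P_entry[OF y'(3) _ p] x(1) by simp
  then have "r s = y \<cdot> p \<cdot> r x"
    unfolding s using x y' by (intro r_mult) (simp_all add: mult_closed head_mult)
  then show ?thesis
    using False y p by (simp add: act_def)
qed

text \<open>The relation is split by the last letters of both words. These fix the targets, as the
  padding requires, and reduce the equation in \<open>S\<close> to one between right multiples of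
  the prefixes in \<open>M\<close>.\<close>

lemma synchronously_regular_translation:
  assumes r: "\<And>x. x \<in> arcs S \<Longrightarrow> head S x = v \<Longrightarrow>
      r x \<in> arcs S \<and> tail S (r x) = tail S x \<and> head S (r x) = v'"
    and r_mult: "\<And>x y. \<lbrakk>x \<in> arcs S; y \<in> arcs S; head S x = tail S y; head S y = v\<rbrakk>
      \<Longrightarrow> r (x \<cdot> y) = x \<cdot> r y"
  shows "synchronously_regular Y
    {(p, q). p \<in> L \<and> q \<in> L \<and> head Y (last p) = v \<and> r (evaluate p) = evaluate q}"
    (is "synchronously_regular Y ?R")
proof (rule synchronously_regularI)
  define J where "J = {(a, a') \<in> arcs X \<times> arcs X. \<exists>j x l j' x' l'.
    \<rho> [a] = Some (j, x, l) \<and> \<rho> [a'] = Some (j', x', l') \<and> head S x = v \<and> G l' = v'}"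
  \<comment> \<open>The last coordinate is taken from \<open>a'\<close>, so that equal arrows give
    equal triples.\<close>
  define c where "c = (\<lambda>(a, a'). case \<rho> [a] of None \<Rightarrow> None | Some (j, x, l) \<Rightarrow>
    (case \<rho> [a'] of None \<Rightarrow> None | Some (j', x', l') \<Rightarrow> Some (j, r x, l')))"
  define coded where "coded a = {(w, encode None (w @ [a])) | w. set (encode None (w @ [a])) \<subseteq> arcs Y}" for a
  \<comment> \<open>Decode \<open>p\<close> to its prefix, pass through a common representative in
    \<open>K\<close> of both products, and encode the prefix of \<open>q\<close>.\<close>
  define T where "T = (\<lambda>(a, a'). (coded a)\<inverse> O
    (right_mult_relation (c (a, a')) O (right_mult_relation (\<rho> [a']))\<inverse>) O coded a')"
  have J: thesis if "(a, a') \<in> J"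
    "\<And>j x l j' x' l'. \<lbrakk>a \<in> arcs X; a' \<in> arcs X; \<rho> [a] = Some (j, x, l); \<rho> [a'] = Some (j', x', l');
      head S x = v; G l' = v'; c (a, a') = Some (j, r x, l'); Some (j, x, l) \<in> M; Some (j, r x, l') \<in> M\<rbrakk>
      \<Longrightarrow> thesis"
    for a a' thesis
  proof -
    from that(1) obtain j x l j' x' l' where *: "a \<in> arcs X" "a' \<in> arcs X" "\<rho> [a] = Some (j, x, l)"
      "\<rho> [a'] = Some (j', x', l')" "head S x = v" "G l' = v'"
      by (auto simp: J_def)
    moreover have M: "Some (j, x, l) \<in> M" "Some (j', x', l') \<in> M"
      using \<rho>_letter_in_M[OF *(1)] \<rho>_letter_in_M[OF *(2)] * by simp_all
    moreover from this have "Some (j, r x, l') \<in> M"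
      using r[of x] * by simp
    ultimately show thesis by (intro that(2)) (auto simp: c_def)
  qed
  have T: "(p, q) \<in> T (a, a') \<longleftrightarrow> (\<exists>w w'. p = encode None (w @ [a]) \<and> q = encode None (w' @ [a']) \<and>
      set p \<subseteq> arcs Y \<and> set q \<subseteq> arcs Y \<and> (w = [] \<or> w \<in> K) \<and> (w' = [] \<or> w' \<in> K) \<and>
      act w (c (a, a')) = act w' (\<rho> [a']))" (is "_ \<longleftrightarrow> ?rhs") if "(a, a') \<in> J" for p q a a'
  proof
    assume "(p, q) \<in> T (a, a')"
    then obtain w w' u where "(w, p) \<in> coded a" "(w', q) \<in> coded a'"
      "(w, u) \<in> right_mult_relation (c (a, a'))" "(w', u) \<in> right_mult_relation (\<rho> [a'])"
      unfolding T_def by auto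
    then show ?rhs
      by (intro exI[of _ w] exI[of _ w']) (simp add: coded_def right_mult_relation_def)
  next
    assume ?rhs
    then obtain w w' where w: "p = encode None (w @ [a])" "q = encode None (w' @ [a'])"
      "set p \<subseteq> arcs Y" "set q \<subseteq> arcs Y" "w = [] \<or> w \<in> K" "w' = [] \<or> w' \<in> K"
      "act w (c (a, a')) = act w' (\<rho> [a'])" by blast
    have "\<rho> [a'] \<in> M" using that by (auto simp: J_def \<rho>_letter_in_M)
    then obtain u where u: "u \<in> K" "\<rho> u = act w' (\<rho> [a'])"
      using w(6) act_in_M representative by blast
    have "(p, w) \<in> (coded a)\<inverse>" "(w', q) \<in> coded a'"
      using w(1-4) by (auto simp: coded_def)
    moreover have "(w, u) \<in> right_mult_relation (c (a, a'))" "(u, w') \<in> (right_mult_relation (\<rho> [a']))\<inverse>"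
      using w u by (auto simp: right_mult_relation_def)
    ultimately show "(p, q) \<in> T (a, a')" unfolding T_def by auto
  qed
  show "wf_digraph Y" "finite (arcs Y)" "finite (verts Y)"
    using wf_Y finite_arcs_Y finite_verts_S by simp_all
  show "?R \<subseteq> arcs (path_graph Y) \<times> arcs (path_graph Y)"
    using L_subset by blast
  have "J \<subseteq> arcs X \<times> arcs X" by (auto simp: J_def)
  then show "finite J" using finite_X by (simp add: finite_subset)
  show "synchronous (T j)" if "j \<in> J" for j
  proof -
    obtain a a' where j: "j = (a, a')" by fastforce
    have "c (a, a') \<in> M" "\<rho> [a'] \<in> M"
      using J[of a a'] that \<rho>_letter_in_M[of a'] unfolding j by metis+
    then show ?thesis
      unfolding j T_def coded_def
      by (simp add: synchronous_relcomp synchronous_converse synchronous_right_mult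
          synchronous_encode_snoc finite_arcs_Y)
  qed
  have member: "(p, q) \<in> ?R \<longleftrightarrow> act w (c (a, a')) = act w' (\<rho> [a'])" (is ?member)
    and heads: "head Y (last p) = v \<and> head Y (last q) = v'" (is ?heads)
    if J': "(a, a') \<in> J" and p: "p = encode None (w @ [a])" and q: "q = encode None (w' @ [a'])"
      and set: "set p \<subseteq> arcs Y" "set q \<subseteq> arcs Y" and w: "w = [] \<or> w \<in> K" "w' = [] \<or> w' \<in> K"
    for a a' p q w w'
  proof -
    obtain j x l j' x' l' where a: "a \<in> arcs X" "a' \<in> arcs X" and x: "\<rho> [a] = Some (j, x, l)"
      and x': "\<rho> [a'] = Some (j', x', l')" and v: "head S x = v" "G l' = v'"
      and c: "c (a, a') = Some (j, r x, l')" and M: "Some (j, x, l) \<in> M"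
      using J[OF J'] by metis
    obtain i where i: "act w (\<rho> [a]) = Some (i, evaluate p, l)" "i = first_index (tail S (evaluate p))"
      "head S x = head S (evaluate p)" "p \<in> arcs (path_graph Y)"
      using L_elem[OF w(1) a(1)] set(1) x unfolding p by (metis Pair_inject option.inject)
    obtain i' where i': "act w' (\<rho> [a']) = Some (i', evaluate q, l')"
      "i' = first_index (tail S (evaluate q))" "head S x' = head S (evaluate q)"
      "q \<in> arcs (path_graph Y)"
      using L_elem[OF w(2) a(2)] set(2) x' unfolding q by (metis Pair_inject option.inject)
    have "head S x' = G l'" using \<rho>_letter_in_M[OF a(2)] x' by simp
    then show ?heads
      using v i(3) i'(3) evaluate_path(3)[OF i(4)] evaluate_path(3)[OF i'(4)] by simp
    moreover have "act w (c (a, a')) = Some (i, r (evaluate p), l')"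
      unfolding c using r_mult w(1) M v(1) i(1)[unfolded x] by (rule act_translate)
    moreover have "tail S (r (evaluate p)) = tail S (evaluate p)"
      using r[of "evaluate p"] evaluate_path(1)[OF i(4)] i(3) v(1) by simp
    \<comment> \<open>First indices depend only on sources, and \<open>r\<close> preserves
      sources.\<close>
    then have "i = i'" if "r (evaluate p) = evaluate q"
      using that i(2) i'(2) by simp
    moreover have "p \<in> L" "q \<in> L" using p q a w set unfolding L_def by blast+
    ultimately show ?member using i'(1) by auto
  qed
  show "?R = (\<Union>j\<in>J. T j)"
  proof (intro equalityI subrelI)
    fix p q assume pq: "(p, q) \<in> ?R"
    then obtain w a w' a' where w: "w = [] \<or> w \<in> K" "w' = [] \<or> w' \<in> K" and a: "a \<in> arcs X" "a' \<in> arcs X"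
      and p: "p = encode None (w @ [a])" "q = encode None (w' @ [a'])"
      and set: "set p \<subseteq> arcs Y" "set q \<subseteq> arcs Y"
      unfolding L_def by blast
    obtain j x l where x: "\<rho> [a] = Some (j, x, l)" "head S x = head S (evaluate p)"
      "p \<in> arcs (path_graph Y)"
      using L_elem[OF w(1) a(1)] set(1) unfolding p by metis
    obtain j' x' l' where x': "\<rho> [a'] = Some (j', x', l')" "head S x' = head S (evaluate q)"
      using L_elem[OF w(2) a(2)] set(2) unfolding p by metis
    have "head S (evaluate p) = v" using pq evaluate_path(3)[OF x(3)] by simp
    moreover from this have "head S (evaluate q) = v'"
      using pq r[of "evaluate p"] evaluate_path(1)[OF x(3)] by simp
    moreover have "head S x' = G l'" using \<rho>_letter_in_M[OF a(2)] x'(1) by simp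
    ultimately have J': "(a, a') \<in> J"
      using a x x' by (simp add: J_def)
    then have "(p, q) \<in> T (a, a')"
      using T[OF J'] member[OF J' p set w] pq p set w by blast
    with J' show "(p, q) \<in> (\<Union>j\<in>J. T j)" by blast
  next
    fix p q assume "(p, q) \<in> (\<Union>j\<in>J. T j)"
    then obtain a a' where J': "(a, a') \<in> J" and "(p, q) \<in> T (a, a')" by auto
    then obtain w w' where w: "p = encode None (w @ [a])" "q = encode None (w' @ [a'])"
      "set p \<subseteq> arcs Y" "set q \<subseteq> arcs Y" "w = [] \<or> w \<in> K" "w' = [] \<or> w' \<in> K"
      and "act w (c (a, a')) = act w' (\<rho> [a'])"
      using T[OF J'] by blast
    then show "(p, q) \<in> ?R" using member[OF J' w] by blast
  qed
  show "head Y (last p) = v \<and> head Y (last q) = v'" if "j \<in> J" "(p, q) \<in> T j" for j p q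
  proof -
    obtain a a' where j: "j = (a, a')" by fastforce
    then have J': "(a, a') \<in> J" and pq: "(p, q) \<in> T (a, a')" using that by simp_all
    obtain w w' where w: "p = encode None (w @ [a])" "q = encode None (w' @ [a'])"
      "set p \<subseteq> arcs Y" "set q \<subseteq> arcs Y" "w = [] \<or> w \<in> K" "w' = [] \<or> w' \<in> K"
      using T[OF J'] pq by blast
    show ?thesis by (rule heads[OF J' w])
  qed
qed

text \<open>Edge relations are the case where \<open>r\<close> multiplies by the value of the edge;
  vertex relations are the case of the identity map.\<close>

lemma automatic_S: "automatic S mult"
proof -
  have "evaluate ` arcs (path_graph Y) = arcs S"
    using evaluate_L L_subset evaluate_path(1) by blast
  then have "choice_of_representatives S mult Y L evaluate"
    unfolding choice_of_representatives_def
    using wf_Y evaluate_hom evaluate_L L_subset by simp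
  moreover have "synchronously_regular Y (edge_relation Y L evaluate g)" if g: "g \<in> arcs Y" for g
  proof -
    have "evaluate (u @ [g]) = evaluate u \<cdot> edge_value g" if "u \<in> L" for u
      using that L_subset unfolding evaluate_def
      by (intro path_value_snoc) (auto simp: path_graph_def)
    then have "edge_relation Y L evaluate g = {(p, q). p \<in> L \<and> q \<in> L \<and>
        head Y (last p) = tail S (edge_value g) \<and> evaluate p \<cdot> edge_value g = evaluate q}"
      by (auto simp: edge_relation_def)
    moreover have "synchronously_regular Y {(p, q). p \<in> L \<and> q \<in> L \<and>
        head Y (last p) = tail S (edge_value g) \<and> evaluate p \<cdot> edge_value g = evaluate q}"
      by (rule synchronously_regular_translation)
        (use edge_value_in_arcs[OF g] in \<open>simp_all add: mult_closed tail_mult head_mult mult_assoc\<close>)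
    ultimately show ?thesis by simp
  qed
  moreover have "synchronously_regular Y (vertex_relation Y L evaluate v)" for v
    using synchronously_regular_translation[of v "\<lambda>s. s" v] by (simp add: vertex_relation_def)
  ultimately have "automatic_structure S mult Y L evaluate"
    using finite_arcs_Y by (simp add: automatic_structure_def)
  then show ?thesis unfolding automatic_def by blast
qed

end

theorem theorem4p7:
  fixes S :: "('o, 's) pre_digraph" and mult :: "'s \<Rightarrow> 's \<Rightarrow> 's"
    and I :: "'i set" and \<Lambda> :: "'l set"
    and F :: "'i \<Rightarrow> 'o" and G :: "'l \<Rightarrow> 'o" and P :: "'l \<Rightarrow> 'i \<Rightarrow> 's option"
  assumes "rees_matrix_data S mult I \<Lambda> F G P"
    and "automatic (one_object_graph (rees_elements S I \<Lambda> F G)) (rees_mult mult P)"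
    and "weakly_right_ideal_generated S mult I \<Lambda> G P {s \<in> arcs S. \<not> identity_arrow S mult s}"
  shows "automatic S mult"
proof -
  obtain X :: "(unit, nat) pre_digraph" and K \<rho> where
    "automatic_structure (one_object_graph (rees_elements S I \<Lambda> F G)) (rees_mult mult P) X K \<rho>"
    using assms(2) unfolding automatic_def by blast
  then interpret automatic_rees S mult I \<Lambda> F G P X K \<rho>
    using assms(1) by (simp add: automatic_rees_def automatic_rees_axioms_def)
  show ?thesis by (rule automatic_S)
qed

end
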